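(* For $\ast\in\{f,c,b\}$ and a normed algebra $A$ let $$R_\ast(A)=\{a\in A:\ \rho(\{a\}\cup M)=\rho(M)\ \text{ for all } M\in\mathcal{M}_\ast(A)\}.$$ Then $R_c<R_f$ on the class $(NA)$ of all normed algebras, and $R_b<R_c$ on the class $(BA)$ of all Banach algebras. Moreover, $R_b$ is not a topological radical (TR) on $(BA)$. Here $R_1<R_2$ on a class $\mathcal{A}$ means that $R_1(A)\subset R_2(A)$ for every $A\in\mathcal{A}$ and the inclusion is strict for some $A\in\mathcal{A}$.
   Context: All algebras are complex and associative; "ideal" means two-sided ideal. For a normed algebra $A$, $\mathcal{M}_f(A)$, $\mathcal{M}_c(A)$, $\mathcal{M}_b(A)$ are the classes of all (nonempty) finite, precompact (totally bounded) and bounded subsets of $A$, respectively. For bounded $M\subset A$, $\|M\|=\sup_{a\in M}\|a\|$, $M^n=\{a_1\cdots a_n: a_i\in M\}$, and $\rho(M)=\inf_n\|M^n\|^{1/n}=\lim_n\|M^n\|^{1/n}$ (the joint spectral radius). For a closed ideal $I$ of $A$, $q_I:A\to A/I$ is the quotient map; a topological isomorphism is an algebra isomorphism continuous together with its inverse. A map $R$ assigning to each Banach algebra $A$ a closed ideal $R(A)$ of $A$ is a topological radical (TR) on $(BA)$ if: (1°) $R(R(A))=R(A)$ for all $A\in(BA)$; (2°) $R(A/R(A))=0$ for all $A\in(BA)$; (3°) $f(R(A))=R(B)$ for every topological isomorphism $f:A\to B$ of Banach algebras; (4°) $q_I(R(A))\subset R(A/I)$ for every closed ideal $I$ of $A\in(BA)$;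 (5°) for every ideal $I$ of $A\in(BA)$ with $I\in(BA)$, $R(I)$ is an ideal of $A$ and $R(I)\subset I\cap R(A)$. *)

theory Defs
  imports "HOL-Analysis.Analysis" "HOL-Algebra.Algebraic_Closure_Type"
begin

section \<open>Complex normed algebras\<close>

text \<open>
  Algebras need not be unital; the field \<^term>\<open>one\<close> inherited from HOL-Algebra's
  records is not used.
\<close>

record 'a nalg = "(complex, 'a) module" +
  alg_norm :: "'a \<Rightarrow> real"

abbreviation complex_ring :: "complex ring"
  where "complex_ring \<equiv> ring_of_type_algebra"

locale complex_normed_algebra = Module.module complex_ring A for A :: "'a nalg" (structure) +
  assumes mult_closed: "\<lbrakk>x \<in> carrier A; y \<in> carrier A\<rbrakk> \<Longrightarrow> x \<otimes> y \<in> carrier A"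
    and mult_assoc: "\<lbrakk>x \<in> carrier A; y \<in> carrier A; z \<in> carrier A\<rbrakk>
      \<Longrightarrow> (x \<otimes> y) \<otimes> z = x \<otimes> (y \<otimes> z)"
    and distr_left: "\<lbrakk>x \<in> carrier A; y \<in> carrier A; z \<in> carrier A\<rbrakk>
      \<Longrightarrow> (x \<oplus> y) \<otimes> z = (x \<otimes> z) \<oplus> (y \<otimes> z)"
    and distr_right: "\<lbrakk>x \<in> carrier A; y \<in> carrier A; z \<in> carrier A\<rbrakk>
      \<Longrightarrow> z \<otimes> (x \<oplus> y) = (z \<otimes> x) \<oplus> (z \<otimes> y)"
    and smult_mult_left: "\<lbrakk>x \<in> carrier A; y \<in> carrier A\<rbrakk> \<Longrightarrow> (c \<odot> x) \<otimes> y = c \<odot> (x \<otimes> y)"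
    and smult_mult_right: "\<lbrakk>x \<in> carrier A; y \<in> carrier A\<rbrakk> \<Longrightarrow> x \<otimes> (c \<odot> y) = c \<odot> (x \<otimes> y)"
    and alg_norm_nonneg: "x \<in> carrier A \<Longrightarrow> 0 \<le> alg_norm A x"
    and alg_norm_eq_0: "x \<in> carrier A \<Longrightarrow> alg_norm A x = 0 \<longleftrightarrow> x = \<zero>"
    and alg_norm_triangle: "\<lbrakk>x \<in> carrier A; y \<in> carrier A\<rbrakk>
      \<Longrightarrow> alg_norm A (x \<oplus> y) \<le> alg_norm A x + alg_norm A y"
    and alg_norm_smult: "x \<in> carrier A \<Longrightarrow> alg_norm A (c \<odot> x) = cmod c * alg_norm A x"
    and alg_norm_mult: "\<lbrakk>x \<in> carrier A; y \<in> carrier A\<rbrakk>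
      \<Longrightarrow> alg_norm A (x \<otimes> y) \<le> alg_norm A x * alg_norm A y"

text \<open>The value outside the carrier is only there because \<^locale>\<open>Metric_space\<close> asks for a
  nonnegative symmetric function on the whole type.\<close>

definition alg_dist :: "'a nalg \<Rightarrow> 'a \<Rightarrow> 'a \<Rightarrow> real" where
  "alg_dist A x y =
     (if x \<in> carrier A \<and> y \<in> carrier A then alg_norm A (x \<ominus>\<^bsub>A\<^esub> y) else 0)"

abbreviation alg_topology :: "'a nalg \<Rightarrow> 'a topology" where
  "alg_topology A \<equiv> Metric_space.mtopology (carrier A) (alg_dist A)"

definition NA :: "'a nalg set" where
  "NA = {A. complex_normed_algebra A}"

definition BA :: "'a nalg set" where
  "BA = {A \<in> NA. Metric_space.mcomplete (carrier A) (alg_dist A)}"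

section \<open>Joint spectral radius\<close>

definition M_f :: "'a nalg \<Rightarrow> 'a set set" where
  "M_f A = {M. M \<noteq> {} \<and> M \<subseteq> carrier A \<and> finite M}"

definition M_c :: "'a nalg \<Rightarrow> 'a set set" where
  "M_c A = {M. M \<noteq> {} \<and> M \<subseteq> carrier A \<and>
     Metric_space.mtotally_bounded (carrier A) (alg_dist A) M}"

definition M_b :: "'a nalg \<Rightarrow> 'a set set" where
  "M_b A = {M. M \<noteq> {} \<and> M \<subseteq> carrier A \<and>
     Metric_space.mbounded (carrier A) (alg_dist A) M}"

definition set_norm :: "'a nalg \<Rightarrow> 'a set \<Rightarrow> real" where
  "set_norm A M = (SUP a\<in>M. alg_norm A a)"

text \<open>Only the powers with exponent at least 1 are meaningful, as there need not be a unit.\<close>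

fun set_power :: "'a nalg \<Rightarrow> 'a set \<Rightarrow> nat \<Rightarrow> 'a set" where
  "set_power A M 0 = {}"
| "set_power A M (Suc 0) = M"
| "set_power A M (Suc (Suc n)) = set_power A M (Suc n) <#>\<^bsub>A\<^esub> M"

definition joint_spectral_radius :: "'a nalg \<Rightarrow> 'a set \<Rightarrow> real" where
  "joint_spectral_radius A M = (INF n\<in>{1..}. root n (set_norm A (set_power A M n)))"

definition jsr_radical :: "('a nalg \<Rightarrow> 'a set set) \<Rightarrow> 'a nalg \<Rightarrow> 'a set" where
  "jsr_radical \<M> A = {a \<in> carrier A. \<forall>M \<in> \<M> A.
     joint_spectral_radius A ({a} \<union> M) = joint_spectral_radius A M}"

definition R_f :: "'a nalg \<Rightarrow> 'a set" where "R_f = jsr_radical M_f"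
definition R_c :: "'a nalg \<Rightarrow> 'a set" where "R_c = jsr_radical M_c"
definition R_b :: "'a nalg \<Rightarrow> 'a set" where "R_b = jsr_radical M_b"

definition strictly_below ::
  "'a nalg set \<Rightarrow> ('a nalg \<Rightarrow> 'a set) \<Rightarrow> ('a nalg \<Rightarrow> 'a set) \<Rightarrow> bool" where
  "strictly_below \<A> R1 R2 \<longleftrightarrow> (\<forall>A\<in>\<A>. R1 A \<subseteq> R2 A) \<and> (\<exists>A\<in>\<A>. R1 A \<subset> R2 A)"

section \<open>Topological radicals\<close>

definition alg_ideal :: "'a nalg \<Rightarrow> 'a set \<Rightarrow> bool" where
  "alg_ideal A I \<longleftrightarrow> submodule I complex_ring A \<and>
     (\<forall>i\<in>I. \<forall>x\<in>carrier A. x \<otimes>\<^bsub>A\<^esub> i \<in> I \<and> i \<otimes>\<^bsub>A\<^esub> x \<in> I)"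

definition closed_alg_ideal :: "'a nalg \<Rightarrow> 'a set \<Rightarrow> bool" where
  "closed_alg_ideal A I \<longleftrightarrow> alg_ideal A I \<and> closedin (alg_topology A) I"

text \<open>An ideal, regarded as a normed algebra with the inherited operations and norm.\<close>

abbreviation sub_nalg :: "'a nalg \<Rightarrow> 'a set \<Rightarrow> 'a nalg" where
  "sub_nalg A I \<equiv> A\<lparr>carrier := I\<rparr>"

text \<open>
  The quotient algebra is realised on a system of representatives of the cosets instead of on
  the set of cosets. In this way \<open>A/I\<close> has the same type as \<open>A\<close>, so that a map \<open>R\<close> on the Banach
  algebras over a type can be applied to both. The quotient map sends \<open>x\<close> to the chosen
  representative of its coset, and the norm is the usual quotient norm.
\<close>

definition quot_map :: "'a nalg \<Rightarrow> 'a set \<Rightarrow> 'a \<Rightarrow> 'a" where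
  "quot_map A I x = (SOME y. y \<in> I +>\<^bsub>A\<^esub> x)"

definition quot_nalg :: "'a nalg \<Rightarrow> 'a set \<Rightarrow> 'a nalg" where
  "quot_nalg A I = \<lparr>
     carrier = quot_map A I ` carrier A,
     monoid.mult = (\<lambda>x y. quot_map A I (x \<otimes>\<^bsub>A\<^esub> y)),
     one = quot_map A I \<one>\<^bsub>A\<^esub>,
     ring.zero = quot_map A I \<zero>\<^bsub>A\<^esub>,
     add = (\<lambda>x y. quot_map A I (x \<oplus>\<^bsub>A\<^esub> y)),
     smult = (\<lambda>c x. quot_map A I (c \<odot>\<^bsub>A\<^esub> x)),
     alg_norm = (\<lambda>x. INF i\<in>I. alg_norm A (x \<oplus>\<^bsub>A\<^esub> i)) \<rparr>"

definition topological_isomorphism :: "'a nalg \<Rightarrow> 'b nalg \<Rightarrow> ('a \<Rightarrow> 'b) \<Rightarrow> bool" where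
  "topological_isomorphism A B f \<longleftrightarrow>
     homeomorphic_map (alg_topology A) (alg_topology B) f \<and>
     (\<forall>x\<in>carrier A. \<forall>y\<in>carrier A. f (x \<oplus>\<^bsub>A\<^esub> y) = f x \<oplus>\<^bsub>B\<^esub> f y) \<and>
     (\<forall>x\<in>carrier A. \<forall>y\<in>carrier A. f (x \<otimes>\<^bsub>A\<^esub> y) = f x \<otimes>\<^bsub>B\<^esub> f y) \<and>
     (\<forall>c. \<forall>x\<in>carrier A. f (c \<odot>\<^bsub>A\<^esub> x) = c \<odot>\<^bsub>B\<^esub> f x)"

definition topological_radical :: "('a nalg \<Rightarrow> 'a set) \<Rightarrow> bool" where
  "topological_radical R \<longleftrightarrow>
     (\<forall>A\<in>BA. closed_alg_ideal A (R A)) \<and>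
     (\<forall>A\<in>BA. R (sub_nalg A (R A)) = R A) \<and>
     (\<forall>A\<in>BA. R (quot_nalg A (R A)) = {\<zero>\<^bsub>quot_nalg A (R A)\<^esub>}) \<and>
     (\<forall>A\<in>BA. \<forall>B\<in>BA. \<forall>f. topological_isomorphism A B f \<longrightarrow> f ` R A = R B) \<and>
     (\<forall>A\<in>BA. \<forall>I. closed_alg_ideal A I \<longrightarrow> quot_map A I ` R A \<subseteq> R (quot_nalg A I)) \<and>
     (\<forall>A\<in>BA. \<forall>I. alg_ideal A I \<and> sub_nalg A I \<in> BA \<longrightarrow>
        alg_ideal A (R (sub_nalg A I)) \<and> R (sub_nalg A I) \<subseteq> I \<inter> R A)"

text \<open>
  No single type contains a copy of every normed algebra, so \<^term>\<open>NA\<close>, \<^term>\<open>BA\<close> and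
  \<^term>\<open>topological_radical\<close> refer to the algebras whose carriers lie in an arbitrary type.
  The types excluded by the following condition carry no algebra other than the zero algebra,
  since a nonzero complex vector space contains a copy of the complex numbers.
\<close>

definition continuum_embeds :: "'a itself \<Rightarrow> bool" where
  "continuum_embeds _ \<longleftrightarrow> (\<exists>f :: complex \<Rightarrow> 'a. inj f)"

end

theory Submission
  imports Defs
begin

text \<open>
  The two inclusions hold because finite sets are precompact and precompact sets are bounded; the
  content lies in two examples. Both are algebras of words: fix a set \<open>W\<close> of nonempty words that is
  closed under taking nonempty factors, let the words of \<open>W\<close> be a basis, multiply two words by
  concatenation and put the product equal to \<open>0\<close> if it leaves \<open>W\<close>; the norm is the \<open>\<ell>\<^sup>1\<close> norm. A joint
  spectral radius is bounded below by exhibiting long products of letters that stay in \<open>W\<close>. It is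
  bounded above by changing the norm (\<open>jsr_le_weighted\<close>): if \<open>\<omega>\<close> is a submultiplicative weight on
  words that is bounded and bounded away from \<open>0\<close>, then \<open>\<Sum>w. \<omega> w * \<bar>a w\<bar>\<close> is an equivalent
  submultiplicative norm, and \<open>\<rho>(M)\<close> is at most the supremum of that norm on \<open>M\<close>.

  Banach algebras, bounded against precompact sets. The letters are \<open>x = 0\<close> and \<open>y\<^sub>i = i\<close> for
  \<open>i \<ge> 1\<close>, and \<open>W\<close> consists of the words in which \<open>x\<close> alternates with pairwise distinct \<open>y\<^sub>i\<close>. The
  bounded set \<open>M = {y\<^sub>1, y\<^sub>2, \<dots>}\<close> has \<open>M\<^sup>2 = 0\<close>, but the words \<open>x y\<^sub>1 x y\<^sub>3 \<dots>\<close> show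
  \<open>\<rho>({x} \<union> M) \<ge> 1\<close>, so \<open>x\<close> is not in \<open>R_b\<close>. A precompact set is up to a small error supported on words
  over finitely many letters \<open>0, \<dots>, m\<close>. Give each of these letters the weight \<open>t < 1\<close> and all the
  others the weight \<open>1/t\<close>. Since each \<open>y\<^sub>i\<close> occurs at most once and the \<open>x\<close> balance the \<open>y\<^sub>i\<close>, this
  weight stays between \<open>t\<^bsup>2m+1\<^esup>\<close> and \<open>1/t\<close>, while it is at most \<open>t\<close> on words over \<open>0, \<dots>, m\<close>. Hence
  \<open>\<rho>\<close> vanishes on every precompact set, and \<open>R_c\<close> is the whole algebra
  (\<open>alternating_precompact_jsr\<close>).

  The same algebra \<open>A\<close> shows that \<open>R_b\<close> is not a topological radical, because
  \<open>R_b(A / R_b(A)) \<noteq> 0\<close>. If \<open>w\<close> contains some \<open>y\<^sub>i\<close>, then \<open>w w = 0\<close> and \<open>w A w = 0\<close>, whence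
  \<open>w \<in> R_b(A)\<close> (\<open>square_zero_ideal_subset_R_b\<close>). Every product of two elements is a limit of linear
  combinations of such words, so if \<open>R_b(A)\<close> were a closed ideal, it would contain all products.
  Then \<open>A / R_b(A)\<close> would have zero multiplication, hence be equal to its own \<open>R_b\<close>, although it is
  not \<open>0\<close> since \<open>x\<close> is not in \<open>R_b(A)\<close> (\<open>not_topological_radicalI\<close>).

  Normed algebras, precompact against finite sets. Let \<open>W\<close> be the set of factors of the ruler words
  \<open>0\<close>, \<open>0 1 0\<close>, \<open>0 1 0 2 0 1 0\<close>, \<open>\<dots>\<close>, and take the incomplete algebra of those elements that involve
  only finitely many letters. A word of \<open>W\<close> over the letters \<open>0, \<dots>, N - 1\<close> is shorter than
  \<open>2\<^sup>N\<close>, so finite sets are nilpotent and \<open>R_f\<close> is everything. The letter \<open>i\<close> occurs with density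
  about \<open>2\<^bsup>-(i+1)\<^esup>\<close>, so that giving it the factor \<open>2\<^bsup>-i\<^esup>\<close> multiplies a word of length \<open>n\<close> by no less
  than \<open>2\<^bsup>-n\<^esup>\<close>, and the null sequence \<open>M = {2\<^bsup>-i\<^esup> i : i \<ge> 0}\<close> has \<open>\<rho>(M) \<ge> 1/2\<close>. Removing the first two
  members leaves a set of norm \<open>1/4\<close>, so one of these two members is not in \<open>R_c\<close>
  (\<open>ruler_R_c_proper\<close>).
\<close>

section \<open>Normed algebras in elementary terms\<close>

lemma complex_ring_simps [simp]:
  "carrier complex_ring = UNIV"
  "x \<otimes>\<^bsub>complex_ring\<^esub> y = x * y"
  "x \<oplus>\<^bsub>complex_ring\<^esub> y = x + y"
  "\<one>\<^bsub>complex_ring\<^esub> = 1"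
  "\<zero>\<^bsub>complex_ring\<^esub> = 0"
  by (simp_all add: ring_of_type_algebra_def)

lemma complex_ring_uminus [simp]: "\<ominus>\<^bsub>complex_ring\<^esub> c = - c"
proof -
  interpret cring complex_ring by (rule cring_from_type_algebra)
  show ?thesis by (rule minus_equality) simp_all
qed

text \<open>
  An introduction rule without the group-theoretic layers: additive inverses come for free from
  multiplication by \<open>-1\<close>.
\<close>

lemma complex_normed_algebraI:
  fixes A :: "'a nalg" (structure)
  assumes zero: "\<zero> \<in> carrier A"
    and add: "\<And>x y. \<lbrakk>x \<in> carrier A; y \<in> carrier A\<rbrakk> \<Longrightarrow> x \<oplus> y \<in> carrier A"
    and smult: "\<And>c x. x \<in> carrier A \<Longrightarrow> c \<odot> x \<in> carrier A"
    and assoc: "\<And>x y z. \<lbrakk>x \<in> carrier A; y \<in> carrier A; z \<in> carrier A\<rbrakk>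
      \<Longrightarrow> (x \<oplus> y) \<oplus> z = x \<oplus> (y \<oplus> z)"
    and comm: "\<And>x y. \<lbrakk>x \<in> carrier A; y \<in> carrier A\<rbrakk> \<Longrightarrow> x \<oplus> y = y \<oplus> x"
    and zero_add: "\<And>x. x \<in> carrier A \<Longrightarrow> \<zero> \<oplus> x = x"
    and zero_smult: "\<And>x. x \<in> carrier A \<Longrightarrow> 0 \<odot> x = \<zero>"
    and smult_left: "\<And>c d x. x \<in> carrier A \<Longrightarrow> (c + d) \<odot> x = c \<odot> x \<oplus> d \<odot> x"
    and smult_right: "\<And>c x y. \<lbrakk>x \<in> carrier A; y \<in> carrier A\<rbrakk>
      \<Longrightarrow> c \<odot> (x \<oplus> y) = c \<odot> x \<oplus> c \<odot> y"
    and smult_smult: "\<And>c d x. x \<in> carrier A \<Longrightarrow> (c * d) \<odot> x = c \<odot> (d \<odot> x)"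
    and one_smult: "\<And>x. x \<in> carrier A \<Longrightarrow> 1 \<odot> x = x"
    and ax: "complex_normed_algebra_axioms A"
  shows "complex_normed_algebra A"
proof -
  have "abelian_group A"
  proof (rule abelian_groupI)
    fix x assume x: "x \<in> carrier A"
    have "(-1) \<odot> x \<oplus> x = (-1 + 1) \<odot> x"
      using smult_left[OF x, of "-1" 1] one_smult[OF x] by simp
    then have "(-1) \<odot> x \<oplus> x = \<zero>" using zero_smult[OF x] by simp
    then show "\<exists>y\<in>carrier A. y \<oplus> x = \<zero>" using smult[OF x] by blast
  qed (use assms in auto)
  then have "Module.module complex_ring A"
    by (intro moduleI cring_from_type_algebra) (use assms in auto)
  then show ?thesis using ax by (simp add: complex_normed_algebra_def)
qed

context complex_normed_algebra
begin

lemma one_csmult [simp]: "x \<in> carrier A \<Longrightarrow> 1 \<odot> x = x"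
  using smult_one[of x] by simp

lemma zero_csmult [simp]: "x \<in> carrier A \<Longrightarrow> 0 \<odot> x = \<zero>"
  using smult_l_null[of x] by simp

text \<open>
  Writing \<open>x - y\<close> as \<open>x + (-1) y\<close> keeps additive inverses out of what follows. They are
  defined by a description and would have to be recomputed in every algebra that is built below.
\<close>

lemma diff_eq: "\<lbrakk>x \<in> carrier A; y \<in> carrier A\<rbrakk> \<Longrightarrow> x \<ominus> y = x \<oplus> (-1) \<odot> y"
  using smult_l_minus[of 1 y] by (simp add: a_minus_def)

lemma csmult_closed [simp]: "x \<in> carrier A \<Longrightarrow> c \<odot> x \<in> carrier A"
  by simp

lemma minus_eq: "x \<in> carrier A \<Longrightarrow> \<ominus> x = (-1) \<odot> x"
  using smult_l_minus[of 1 x] by simp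

lemma mult_zero [simp]:
  assumes "x \<in> carrier A" shows "x \<otimes> \<zero> = \<zero>" "\<zero> \<otimes> x = \<zero>"
  using smult_mult_left[of \<zero> x 0] smult_mult_right[of x \<zero> 0] assms by (simp_all add: mult_closed)

lemma alg_dist_eq:
  "\<lbrakk>x \<in> carrier A; y \<in> carrier A\<rbrakk> \<Longrightarrow> alg_dist A x y = alg_norm A (x \<oplus> (-1) \<odot> y)"
  by (simp add: alg_dist_def diff_eq)

lemma norm_minus: "x \<in> carrier A \<Longrightarrow> alg_norm A (\<ominus> x) = alg_norm A x"
  by (simp add: minus_eq alg_norm_smult)

lemma norm_zero [simp]: "alg_norm A \<zero> = 0"
  by (simp add: alg_norm_eq_0)

lemma minus_zero_eq [simp]: "\<ominus> \<zero> = \<zero>"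
  by (rule M.minus_equality) simp_all

lemma norm_diff_commute:
  assumes "x \<in> carrier A" "y \<in> carrier A"
  shows "alg_norm A (x \<ominus> y) = alg_norm A (y \<ominus> x)"
proof -
  have "y \<ominus> x = \<ominus> (x \<ominus> y)"
    using assms by (simp add: a_minus_def M.minus_add M.add.m_comm)
  then show ?thesis using norm_minus assms by simp
qed

lemma norm_diff_triangle:
  assumes "x \<in> carrier A" "y \<in> carrier A" "z \<in> carrier A"
  shows "alg_norm A (x \<ominus> z) \<le> alg_norm A (x \<ominus> y) + alg_norm A (y \<ominus> z)"
proof -
  have "x \<ominus> z = (x \<ominus> y) \<oplus> (y \<ominus> z)"
    using assms by (simp add: a_minus_def M.a_assoc M.r_neg1 M.r_neg2)
  then show ?thesis using alg_norm_triangle[of "x \<ominus> y" "y \<ominus> z"] assms by simp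
qed

sublocale Metric_space "carrier A" "alg_dist A"
proof
  show "0 \<le> alg_dist A x y" for x y
    by (simp add: alg_dist_def alg_norm_nonneg)
  show "alg_dist A x y = alg_dist A y x" for x y
    by (simp add: alg_dist_def norm_diff_commute)
  show "(alg_dist A x y = 0) = (x = y)" if xy: "x \<in> carrier A" "y \<in> carrier A" for x y
  proof -
    have "x = (x \<ominus> y) \<oplus> y" using xy by (simp add: a_minus_def M.a_assoc M.l_neg)
    then have "x \<ominus> y = \<zero> \<longleftrightarrow> x = y" using xy by (metis M.l_zero M.r_neg a_minus_def)
    then show ?thesis using xy by (simp add: alg_dist_def alg_norm_eq_0)
  qed
  show "alg_dist A x z \<le> alg_dist A x y + alg_dist A y z"
    if "x \<in> carrier A" "y \<in> carrier A" "z \<in> carrier A" for x y z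
    using that norm_diff_triangle[of x y z] by (simp add: alg_dist_def)
qed

lemma M_b_iff: "M \<in> M_b A \<longleftrightarrow> M \<noteq> {} \<and> M \<subseteq> carrier A \<and> (\<exists>C. \<forall>a\<in>M. alg_norm A a \<le> C)"
proof -
  have "mbounded M \<longleftrightarrow> (\<exists>C. \<forall>a\<in>M. alg_norm A a \<le> C)" if M: "M \<noteq> {}" "M \<subseteq> carrier A"
  proof
    assume "mbounded M"
    then obtain y B where y: "y \<in> carrier A" "\<forall>x\<in>M. alg_dist A y x \<le> B"
      using M mbounded[of M] by auto
    have "alg_norm A a \<le> B + alg_norm A y" if "a \<in> M" for a
    proof -
      have a: "a \<in> carrier A" using that \<open>M \<subseteq> carrier A\<close> by blast
      have "alg_norm A a \<le> alg_norm A (a \<ominus> y) + alg_norm A y"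
        using norm_diff_triangle[of a y \<zero>] a y by (simp add: a_minus_def)
      also have "alg_norm A (a \<ominus> y) = alg_dist A y a"
        using a y by (simp add: alg_dist_def norm_diff_commute)
      finally show ?thesis using y that by force
    qed
    then show "\<exists>C. \<forall>a\<in>M. alg_norm A a \<le> C" by blast
  next
    assume "\<exists>C. \<forall>a\<in>M. alg_norm A a \<le> C"
    then obtain C where C: "\<forall>a\<in>M. alg_norm A a \<le> C" by blast
    have "alg_dist A \<zero> a \<le> C" if "a \<in> M" for a
      using C that \<open>M \<subseteq> carrier A\<close> norm_minus by (auto simp: alg_dist_def a_minus_def)
    then show "mbounded M" using mbounded \<open>M \<subseteq> carrier A\<close> by blast
  qed
  then show ?thesis by (auto simp: M_b_def)
qed

lemma insert_bounded: "\<lbrakk>M \<in> M_b A; a \<in> carrier A\<rbrakk> \<Longrightarrow> {a} \<union> M \<in> M_b A"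
  by (simp add: M_b_def mbounded_insert)

lemma M_c_iff: "M \<in> M_c A \<longleftrightarrow> M \<noteq> {} \<and> M \<subseteq> carrier A \<and>
    (\<forall>\<epsilon>>0. \<exists>K. finite K \<and> K \<subseteq> M \<and> (\<forall>a\<in>M. \<exists>b\<in>K. alg_norm A (b \<oplus> (-1) \<odot> a) < \<epsilon>))"
proof -
  have eq: "(finite K \<and> K \<subseteq> M \<and> M \<subseteq> (\<Union>x\<in>K. mball x \<epsilon>)) \<longleftrightarrow>
      (finite K \<and> K \<subseteq> M \<and> (\<forall>a\<in>M. \<exists>b\<in>K. alg_norm A (b \<oplus> (-1) \<odot> a) < \<epsilon>))"
    if "M \<subseteq> carrier A" for K \<epsilon>
  proof (cases "K \<subseteq> M")
    case True
    have "a \<in> mball b \<epsilon> \<longleftrightarrow> alg_norm A (b \<oplus> (-1) \<odot> a) < \<epsilon>" if "a \<in> M" "b \<in> K" for a b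
      using that \<open>M \<subseteq> carrier A\<close> True alg_dist_eq[of b a] by (auto simp: mball_def subset_iff)
    then show ?thesis by (auto simp: subset_iff)
  qed simp
  show ?thesis
    by (cases "M \<subseteq> carrier A") (simp_all add: M_c_def mtotally_bounded_def eq)
qed

lemma M_c_subset_M_b: "M_c A \<subseteq> M_b A"
  using mtotally_bounded_imp_mbounded by (auto simp: M_b_def M_c_def)

lemma M_f_subset_M_c: "M_f A \<subseteq> M_c A"
proof
  fix M assume "M \<in> M_f A"
  then have M: "M \<noteq> {}" "M \<subseteq> carrier A" "finite M" by (auto simp: M_f_def)
  have "alg_norm A (a \<oplus> (-1) \<odot> a) = 0" if "a \<in> M" for a
  proof -
    have "a \<in> carrier A" using that M by blast
    then show ?thesis using diff_eq[of a a] by (simp add: a_minus_def M.r_neg flip: diff_eq)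
  qed
  then have "\<forall>a\<in>M. \<exists>b\<in>M. alg_norm A (b \<oplus> (-1) \<odot> a) < \<epsilon>" if "0 < \<epsilon>" for \<epsilon>
    using that by force
  then show "M \<in> M_c A" unfolding M_c_iff using M by blast
qed

lemma closedin_iff: "closedin mtopology S \<longleftrightarrow> S \<subseteq> carrier A \<and>
    (\<forall>x\<in>carrier A. (\<forall>\<epsilon>>0. \<exists>y\<in>S. alg_norm A (x \<oplus> (-1) \<odot> y) < \<epsilon>) \<longrightarrow> x \<in> S)"
proof -
  have "disjnt S (mball x r) \<longleftrightarrow> \<not> (\<exists>y\<in>S. alg_norm A (x \<oplus> (-1) \<odot> y) < r)"
    if "S \<subseteq> carrier A" "x \<in> carrier A" for x r
  proof -
    have "y \<in> mball x r \<longleftrightarrow> alg_norm A (x \<oplus> (-1) \<odot> y) < r" if "y \<in> S" for y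
      using that \<open>S \<subseteq> carrier A\<close> \<open>x \<in> carrier A\<close> alg_dist_eq[of x y] by (auto simp: mball_def subset_iff)
    then show ?thesis by (auto simp: disjnt_iff)
  qed
  then show ?thesis unfolding closedin_metric by (auto; meson)
qed

lemma mcomplete_iff: "mcomplete \<longleftrightarrow> (\<forall>f :: nat \<Rightarrow> 'a. range f \<subseteq> carrier A \<longrightarrow>
    (\<forall>\<epsilon>>0. \<exists>N. \<forall>m\<ge>N. \<forall>n\<ge>N. alg_norm A (f m \<oplus> (-1) \<odot> f n) < \<epsilon>) \<longrightarrow>
    (\<exists>x\<in>carrier A. \<forall>\<epsilon>>0. \<exists>N. \<forall>n\<ge>N. alg_norm A (f n \<oplus> (-1) \<odot> x) < \<epsilon>))"
proof -
  have C: "MCauchy f \<longleftrightarrow> (\<forall>\<epsilon>>0. \<exists>N. \<forall>m\<ge>N. \<forall>n\<ge>N. alg_norm A (f m \<oplus> (-1) \<odot> f n) < \<epsilon>)"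
    if f: "range f \<subseteq> carrier A" for f
  proof -
    have "alg_dist A (f m) (f n) = alg_norm A (f m \<oplus> (-1) \<odot> f n)" for m n
      using f by (intro alg_dist_eq) auto
    then show ?thesis using f unfolding MCauchy_def by auto
  qed
  have L: "limitin mtopology f x sequentially \<longleftrightarrow>
      x \<in> carrier A \<and> (\<forall>\<epsilon>>0. \<exists>N. \<forall>n\<ge>N. alg_norm A (f n \<oplus> (-1) \<odot> x) < \<epsilon>)"
    if f: "range f \<subseteq> carrier A" for f x
  proof (cases "x \<in> carrier A")
    case True
    have "alg_dist A (f n) x = alg_norm A (f n \<oplus> (-1) \<odot> x)" for n
      using f True by (intro alg_dist_eq) auto
    moreover have "f n \<in> carrier A" for n using f by blast
    ultimately show ?thesis using True unfolding limit_metric_sequentially by simp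
  qed (simp add: limit_metric_sequentially)
  have "mcomplete \<longleftrightarrow> (\<forall>f :: nat \<Rightarrow> 'a. range f \<subseteq> carrier A \<longrightarrow> MCauchy f \<longrightarrow>
      (\<exists>x. limitin mtopology f x sequentially))"
    unfolding mcomplete_def using MCauchy_def by blast
  also have "\<dots> \<longleftrightarrow> (\<forall>f :: nat \<Rightarrow> 'a. range f \<subseteq> carrier A \<longrightarrow>
    (\<forall>\<epsilon>>0. \<exists>N. \<forall>m\<ge>N. \<forall>n\<ge>N. alg_norm A (f m \<oplus> (-1) \<odot> f n) < \<epsilon>) \<longrightarrow>
    (\<exists>x\<in>carrier A. \<forall>\<epsilon>>0. \<exists>N. \<forall>n\<ge>N. alg_norm A (f n \<oplus> (-1) \<odot> x) < \<epsilon>))"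
    by (intro iff_allI HOL.imp_cong HOL.refl) (simp_all only: C L Bex_def)
  finally show ?thesis .
qed

section \<open>The joint spectral radius\<close>

lemma set_power_Suc: "n \<ge> 1 \<Longrightarrow> set_power A M (Suc n) = set_power A M n <#> M"
  by (cases n) simp_all

lemma set_power_SucE:
  assumes "z \<in> set_power A M (Suc n)" "n \<ge> 1"
  obtains u v where "u \<in> set_power A M n" "v \<in> M" "z = u \<otimes> v"
  using assms by (auto simp: set_power_Suc set_mult_def)

lemma set_power_SucI: "\<lbrakk>u \<in> set_power A M n; v \<in> M; n \<ge> 1\<rbrakk> \<Longrightarrow> u \<otimes> v \<in> set_power A M (Suc n)"
  by (auto simp: set_power_Suc set_mult_def)

lemma set_power_closed:
  assumes "M \<subseteq> carrier A" shows "set_power A M n \<subseteq> carrier A"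
proof (induction n rule: nat_induct)
  case (Suc n)
  then show ?case
  proof (cases "n \<ge> 1")
    case True
    then show ?thesis using Suc assms by (auto elim!: set_power_SucE simp: subset_iff mult_closed)
  next
    case False
    then have "n = 0" by simp
    then show ?thesis using assms by simp
  qed
qed simp

lemma set_power_nonempty:
  assumes "M \<noteq> {}" "n \<ge> 1" shows "set_power A M n \<noteq> {}"
  using assms(2)
proof (induction n rule: dec_induct)
  case (step n)
  then show ?case using assms(1) set_power_SucI by blast
qed (use assms in simp)

lemma set_power_mono:
  assumes "M \<subseteq> N" shows "set_power A M n \<subseteq> set_power A N n"
proof (induction n)
  case (Suc n)
  then show ?case
  proof (cases "n \<ge> 1")
    case True
    then show ?thesis using Suc assms by (force elim!: set_power_SucE intro!: set_power_SucI)
  next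
    case False
    then have "n = 0" by simp
    then show ?thesis using assms by simp
  qed
qed simp

lemma set_power_add:
  assumes "z \<in> set_power A M (m + n)" "M \<subseteq> carrier A" "m \<ge> 1" "n \<ge> 1"
  obtains u v where "u \<in> set_power A M m" "v \<in> set_power A M n" "z = u \<otimes> v"
proof -
  have "\<exists>u\<in>set_power A M m. \<exists>v\<in>set_power A M n. z = u \<otimes> v"
    using assms(4,1)
  proof (induction n arbitrary: z rule: dec_induct)
    case base
    then show ?case using assms(3) by (auto elim!: set_power_SucE)
  next
    case (step n)
    then obtain y v where y: "y \<in> set_power A M (m + n)" "v \<in> M" "z = y \<otimes> v"
      using assms(3) set_power_SucE[of z M "m + n"] by auto
    obtain u w where u: "u \<in> set_power A M m" "w \<in> set_power A M n" "y = u \<otimes> w"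
      using step.IH[OF y(1)] by blast
    have "u \<in> carrier A" "w \<in> carrier A" "v \<in> carrier A"
      using u y assms(2) set_power_closed by blast+
    then have "z = u \<otimes> (w \<otimes> v)" using u y mult_assoc by simp
    then show ?case using u y step.hyps set_power_SucI by blast
  qed
  then show ?thesis using that by blast
qed

lemma set_power_norm_le:
  assumes M: "M \<subseteq> carrier A" and C: "\<And>a. a \<in> M \<Longrightarrow> alg_norm A a \<le> C"
    and z: "z \<in> set_power A M n" "n \<ge> 1"
  shows "alg_norm A z \<le> C ^ n"
  using z(2,1)
proof (induction n arbitrary: z rule: dec_induct)
  case (step n)
  then obtain u v where u: "u \<in> set_power A M n" "v \<in> M" "z = u \<otimes> v"
    by (auto elim: set_power_SucE)
  have "u \<in> carrier A" "v \<in> carrier A" using u set_power_closed M by blast+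
  then have "alg_norm A z \<le> alg_norm A u * alg_norm A v" "0 \<le> alg_norm A u" "0 \<le> alg_norm A v"
    using u alg_norm_mult alg_norm_nonneg by auto
  moreover have "alg_norm A u * alg_norm A v \<le> C ^ n * C"
    using step.IH[OF u(1)] C[OF u(2)] \<open>0 \<le> alg_norm A u\<close> \<open>0 \<le> alg_norm A v\<close> by (intro mult_mono) auto
  ultimately show ?case by (simp add: mult.commute)
qed (use C in simp)

lemma set_power_bounded:
  assumes "M \<in> M_b A" "n \<ge> 1" shows "set_power A M n \<in> M_b A"
proof -
  obtain C where C: "\<And>a. a \<in> M \<Longrightarrow> alg_norm A a \<le> C" and M: "M \<noteq> {}" "M \<subseteq> carrier A"
    using assms(1) unfolding M_b_iff by blast
  have "\<forall>z\<in>set_power A M n. alg_norm A z \<le> C ^ n"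
    using set_power_norm_le[OF M(2) C _ assms(2)] by blast
  then have "\<exists>D. \<forall>z\<in>set_power A M n. alg_norm A z \<le> D" ..
  then show ?thesis
    using set_power_closed[OF M(2), of n] set_power_nonempty[OF M(1) assms(2)] M_b_iff[of "set_power A M n"]
    by simp
qed

lemma norm_le_set_norm:
  assumes "M \<in> M_b A" "a \<in> M" shows "alg_norm A a \<le> set_norm A M"
proof -
  obtain C where C: "\<forall>x\<in>M. alg_norm A x \<le> C" using assms(1) M_b_iff[of M] by auto
  have "bdd_above (alg_norm A ` M)" by (rule bdd_aboveI2[of M _ C]) (use C in simp)
  then show ?thesis unfolding set_norm_def by (rule cSUP_upper[OF assms(2)])
qed

lemma set_norm_le: "\<lbrakk>M \<noteq> {}; \<And>a. a \<in> M \<Longrightarrow> alg_norm A a \<le> C\<rbrakk> \<Longrightarrow> set_norm A M \<le> C"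
  unfolding set_norm_def by (rule cSUP_least)

lemma set_norm_nonneg: "M \<in> M_b A \<Longrightarrow> 0 \<le> set_norm A M"
proof -
  assume M: "M \<in> M_b A"
  then obtain a where a: "a \<in> M" "a \<in> carrier A" unfolding M_b_iff by blast
  then show ?thesis using norm_le_set_norm[OF M a(1)] alg_norm_nonneg[OF a(2)] by linarith
qed

lemma set_norm_singleton_zero [simp]: "set_norm A {\<zero>} = 0"
  by (simp add: set_norm_def)

lemma jsr_le_root:
  assumes "M \<in> M_b A" "n \<ge> 1"
  shows "joint_spectral_radius A M \<le> root n (set_norm A (set_power A M n))"
  unfolding joint_spectral_radius_def
proof (rule cINF_lower)
  show "bdd_below ((\<lambda>n. root n (set_norm A (set_power A M n))) ` {1..})"
    using assms by (auto intro!: bdd_belowI[where m = 0] simp: set_norm_nonneg set_power_bounded)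
qed (use assms in auto)

lemma jsr_geI:
  assumes "M \<in> M_b A" "0 \<le> c" "\<And>n. n \<ge> 1 \<Longrightarrow> c ^ n \<le> set_norm A (set_power A M n)"
  shows "c \<le> joint_spectral_radius A M"
  unfolding joint_spectral_radius_def
proof (rule cINF_greatest)
  fix n :: nat assume "n \<in> {1..}"
  then have n: "n \<ge> 1" "0 < n" by auto
  have "root n (c ^ n) \<le> root n (set_norm A (set_power A M n))"
    using n(2) assms(3)[OF n(1)] by (rule real_root_le_mono)
  then show "c \<le> root n (set_norm A (set_power A M n))"
    using n(2) assms(2) by (simp add: real_root_power_cancel)
qed simp

lemma jsr_nonneg: "M \<in> M_b A \<Longrightarrow> 0 \<le> joint_spectral_radius A M"
  by (rule jsr_geI) (auto simp: set_norm_nonneg set_power_bounded power_0_left)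

text \<open>
  A constant factor does not matter because its \<open>n\<close>-th root tends to \<open>1\<close>.
\<close>

lemma jsr_leI:
  assumes M: "M \<in> M_b A" and s: "0 \<le> s"
    and C: "\<And>n a. \<lbrakk>n \<ge> 1; a \<in> set_power A M n\<rbrakk> \<Longrightarrow> alg_norm A a \<le> C * s ^ n"
  shows "joint_spectral_radius A M \<le> s"
proof (rule LIMSEQ_le_const)
  define D where "D = max C 1"
  show "(\<lambda>n. root n D * s) \<longlonglongrightarrow> s"
    using tendsto_mult[OF LIMSEQ_root_const[of D] tendsto_const[of s]] by (simp add: D_def)
  have "joint_spectral_radius A M \<le> root n D * s" if n: "n \<ge> 1" for n
  proof -
    have "joint_spectral_radius A M \<le> root n (set_norm A (set_power A M n))"
      using jsr_le_root[OF M n] .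
    also have "\<dots> \<le> root n (D * s ^ n)"
    proof (rule real_root_le_mono)
      have "alg_norm A a \<le> D * s ^ n" if "a \<in> set_power A M n" for a
        using C[OF n that] mult_right_mono[of C D "s ^ n"] s by (force simp: D_def)
      then show "set_norm A (set_power A M n) \<le> D * s ^ n"
        using set_power_nonempty M n by (intro set_norm_le) (auto simp: M_b_iff)
    qed (use n in auto)
    also have "\<dots> = root n D * s"
      using n s by (simp add: real_root_mult real_root_power_cancel)
    finally show ?thesis .
  qed
  then show "\<exists>N. \<forall>n\<ge>N. joint_spectral_radius A M \<le> root n D * s" by blast
qed

lemma jsr_le_set_norm: "M \<in> M_b A \<Longrightarrow> joint_spectral_radius A M \<le> set_norm A M"
  using jsr_le_root[of M 1] by simp

lemma jsr_mono:
  assumes "M \<subseteq> N" "M \<noteq> {}" "N \<in> M_b A"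
  shows "joint_spectral_radius A M \<le> joint_spectral_radius A N"
proof -
  have M: "M \<in> M_b A" using assms by (auto simp: M_b_iff)
  have "joint_spectral_radius A M \<le> root n (set_norm A (set_power A N n))" if n: "n \<ge> 1" for n
  proof -
    have "set_norm A (set_power A M n) \<le> set_norm A (set_power A N n)"
    proof (rule set_norm_le[OF set_power_nonempty[OF assms(2) n]])
      fix a assume "a \<in> set_power A M n"
      then have "a \<in> set_power A N n" using set_power_mono[OF assms(1)] by blast
      then show "alg_norm A a \<le> set_norm A (set_power A N n)"
        by (rule norm_le_set_norm[OF set_power_bounded[OF assms(3) n]])
    qed
    then have "root n (set_norm A (set_power A M n)) \<le> root n (set_norm A (set_power A N n))"
      using n by (intro real_root_le_mono) auto
    then show ?thesis using jsr_le_root[OF M n] by linarith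
  qed
  then show ?thesis
    unfolding joint_spectral_radius_def[of A N] by (intro cINF_greatest) auto
qed

lemma jsr_square_zero:
  assumes M: "M \<in> M_b A" and "\<And>a b. \<lbrakk>a \<in> M; b \<in> M\<rbrakk> \<Longrightarrow> a \<otimes> b = \<zero>"
  shows "joint_spectral_radius A M = 0"
proof (rule antisym)
  have "set_power A M 2 \<noteq> {}" "set_power A M 2 \<subseteq> {\<zero>}"
    using set_power_nonempty[of M 2] M assms(2)
    by (auto simp: M_b_iff numeral_2_eq_2 set_mult_def)
  then have "set_power A M 2 = {\<zero>}" by blast
  then show "joint_spectral_radius A M \<le> 0" using jsr_le_root[OF M, of 2] by simp
qed (rule jsr_nonneg[OF M])

text \<open>
  Fekete's argument: one exponent \<open>p\<close> with \<open>\<parallel>M\<^sup>p\<parallel> \<le> s\<^sup>p\<close> controls all powers, as \<open>M\<^sup>n\<close> is a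
  product of copies of \<open>M\<^sup>p\<close> and a remainder with exponent at most \<open>p\<close>.
\<close>

lemma set_power_geometric:
  assumes M: "M \<in> M_b A" and s: "joint_spectral_radius A M < s"
  obtains C where "C \<ge> 1" "\<And>n a. \<lbrakk>n \<ge> 1; a \<in> set_power A M n\<rbrakk> \<Longrightarrow> alg_norm A a \<le> C * s ^ n"
proof -
  have s0: "0 < s" using jsr_nonneg[OF M] s by linarith
  have Mc: "M \<subseteq> carrier A" using M by (simp add: M_b_iff)
  obtain p where p: "p \<ge> 1" "root p (set_norm A (set_power A M p)) < s"
    using s cINF_less_iff[of "{1::nat..}" "\<lambda>n. root n (set_norm A (set_power A M n))" s]
    unfolding joint_spectral_radius_def
    by (metis (no_types, lifting) atLeast_iff cINF_greatest empty_iff linorder_not_le order.refl)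
  have "set_norm A (set_power A M p) = root p (set_norm A (set_power A M p)) ^ p"
    using p set_norm_nonneg[OF set_power_bounded[OF M p(1)]] by simp
  also have "\<dots> \<le> s ^ p"
    using p set_norm_nonneg[OF set_power_bounded[OF M p(1)]] by (intro power_mono) auto
  finally have step: "alg_norm A a \<le> s ^ p" if "a \<in> set_power A M p" for a
    using norm_le_set_norm[OF set_power_bounded[OF M p(1)] that] by linarith
  \<comment> \<open>large enough for the exponents up to \<open>p\<close>\<close>
  define B where "B = 1 + (\<Sum>r = 1..p. set_norm A (set_power A M r) / s ^ r)"
  have nn: "0 \<le> set_norm A (set_power A M r) / s ^ r" if "r \<in> {1..p}" for r
    using that s0 set_norm_nonneg[OF set_power_bounded[OF M]] by simp
  have "0 \<le> (\<Sum>r = 1..p. set_norm A (set_power A M r) / s ^ r)" by (rule sum_nonneg) (rule nn)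
  then have B: "B \<ge> 1" unfolding B_def by simp
  have small: "alg_norm A a \<le> B * s ^ n" if "n \<in> {1..p}" "a \<in> set_power A M n" for n a
  proof -
    have "set_norm A (set_power A M n) / s ^ n \<le> B"
      using member_le_sum[OF that(1), of "\<lambda>r. set_norm A (set_power A M r) / s ^ r"] nn
      unfolding B_def by simp
    then show ?thesis
      using norm_le_set_norm[OF set_power_bounded[OF M] that(2)] that(1) s0 by (simp add: field_simps)
  qed
  have "alg_norm A a \<le> B * s ^ n" if "n \<ge> 1" "a \<in> set_power A M n" for n a
    using that
  proof (induction n arbitrary: a rule: less_induct)
    case (less n)
    show ?case
    proof (cases "n \<le> p")
      case True then show ?thesis using small less.prems by simp
    next
      case False
      then have a: "a \<in> set_power A M (p + (n - p))" and n: "n - p \<ge> 1" using less.prems by auto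
      obtain u v where u: "u \<in> set_power A M p" "v \<in> set_power A M (n - p)" "a = u \<otimes> v"
        by (rule set_power_add[OF a Mc p(1) n])
      have uv: "u \<in> carrier A" "v \<in> carrier A" using u set_power_closed[OF Mc] by auto
      have "alg_norm A v \<le> B * s ^ (n - p)"
        using less.IH[of "n - p" v] u False p(1) by simp
      then have "alg_norm A u * alg_norm A v \<le> s ^ p * (B * s ^ (n - p))"
        using step[OF u(1)] uv s0 alg_norm_nonneg by (intro mult_mono) auto
      also have "\<dots> = B * (s ^ p * s ^ (n - p))" by (simp only: mult.left_commute)
      also have "s ^ p * s ^ (n - p) = s ^ n" using False by (simp flip: power_add)
      finally show ?thesis using alg_norm_mult[OF uv] u(3) by simp
    qed
  qed
  then show ?thesis using that B by blast
qed

text \<open>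
  A product of elements of \<open>M\<close> and copies of \<open>a\<close> is \<open>0\<close> as soon as \<open>a\<close> occurs twice. The
  other products have the form \<open>u\<close>, \<open>a\<close>, \<open>u a\<close>, \<open>a v\<close> or \<open>u a v\<close> with \<open>u\<close> and \<open>v\<close> in powers of \<open>M\<close>, and
  a single factor \<open>a\<close> does not change the exponential growth rate.
\<close>

lemma square_zero_ideal_subset_R_b:
  assumes a: "a \<in> carrier A" "a \<otimes> a = \<zero>" and aAa: "\<And>b. b \<in> carrier A \<Longrightarrow> a \<otimes> b \<otimes> a = \<zero>"
  shows "a \<in> R_b A"
proof -
  have "joint_spectral_radius A ({a} \<union> M) \<le> joint_spectral_radius A M" if M: "M \<in> M_b A" for M
  proof (rule dense_ge)
    fix s assume s: "joint_spectral_radius A M < s"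
    have s0: "0 < s" using jsr_nonneg[OF M] s by linarith
    have Mc: "M \<subseteq> carrier A" using M by (simp add: M_b_iff)
    have aM: "{a} \<union> M \<in> M_b A" using insert_bounded[OF M a(1)] .
    obtain C where C: "C \<ge> 1" "\<And>n a. \<lbrakk>n \<ge> 1; a \<in> set_power A M n\<rbrakk> \<Longrightarrow> alg_norm A a \<le> C * s ^ n"
      using set_power_geometric[OF M s] by blast
    \<comment> \<open>the products with exactly one factor \<open>a\<close>, at the end; the case distinction replaces a unit\<close>
    define U where "U i = (if i = 0 then {a} else {u \<otimes> a | u. u \<in> set_power A M i})" for i
    have U_closed: "y \<in> carrier A" if "y \<in> U i" for y i
      using that a set_power_closed[OF Mc, of i]
      by (auto simp: U_def subset_iff intro!: mult_closed split: if_splits)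
    have U_kill: "y \<otimes> a = \<zero>" "\<And>b. b \<in> carrier A \<Longrightarrow> y \<otimes> b \<otimes> a = \<zero>" if y: "y \<in> U i" for y i
    proof -
      obtain u where u: "y = a \<or> y = u \<otimes> a \<and> u \<in> carrier A"
        using y a set_power_closed[OF Mc, of i] by (auto simp: U_def subset_iff split: if_splits)
      then show "y \<otimes> a = \<zero>" using a by (auto simp: mult_assoc)
      fix b assume b: "b \<in> carrier A"
      have "u \<otimes> a \<otimes> b \<otimes> a = u \<otimes> (a \<otimes> b \<otimes> a)" if "u \<in> carrier A"
        using that a b by (simp add: mult_assoc mult_closed)
      then show "y \<otimes> b \<otimes> a = \<zero>" using u aAa[OF b] by auto
    qed
    \<comment> \<open>a factor \<open>a\<close> replaces one element of \<open>M\<close>, hence the division by \<open>s\<close>\<close>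
    define K where "K = C * C * (alg_norm A a / s + 1)"
    have na: "0 \<le> alg_norm A a" using a alg_norm_nonneg by blast
    have U_norm: "alg_norm A y \<le> C * s ^ i * alg_norm A a" if y: "y \<in> U i" for y i
    proof (cases "i = 0")
      case True
      then show ?thesis using y C(1) na mult_right_mono[of 1 C "alg_norm A a"] by (simp add: U_def)
    next
      case False
      then obtain u where u: "u \<in> set_power A M i" "y = u \<otimes> a" using y by (auto simp: U_def)
      then have "alg_norm A y \<le> alg_norm A u * alg_norm A a"
        using alg_norm_mult a set_power_closed[OF Mc] by blast
      also have "\<dots> \<le> C * s ^ i * alg_norm A a" using C(2)[of i u] u False na by (intro mult_right_mono) auto
      finally show ?thesis .
    qed
    have shape: "z = \<zero> \<or> z \<in> set_power A M n \<or>
        (\<exists>i y. y \<in> U i \<and> (z = y \<and> Suc i = n \<or>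
          (\<exists>j v. j \<ge> 1 \<and> v \<in> set_power A M j \<and> z = y \<otimes> v \<and> Suc (i + j) = n)))"
      if "n \<ge> 1" "z \<in> set_power A ({a} \<union> M) n" for n z
      using that
    proof (induction n arbitrary: z rule: dec_induct)
      case base
      then show ?case by (auto simp: U_def)
    next
      case (step n)
      obtain x w where x: "x \<in> set_power A ({a} \<union> M) n" "w \<in> {a} \<union> M" "z = x \<otimes> w"
        by (rule set_power_SucE[OF step.prems step.hyps(1)])
      have w: "w \<in> carrier A" using x a Mc by blast
      consider "x = \<zero>" | "x \<in> set_power A M n"
        | i where "x \<in> U i" "Suc i = n"
        | i y j v where "y \<in> U i" "j \<ge> 1" "v \<in> set_power A M j" "x = y \<otimes> v" "Suc (i + j) = n"
        using step.IH[OF x(1)] by blast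
      then show ?case
      proof cases
        case 1 then show ?thesis using w x by simp
      next
        case 2
        show ?thesis
        proof (cases "w = a")
          case True
          then have "z \<in> U n" using 2 x step.hyps by (auto simp: U_def)
          then show ?thesis by blast
        next
          case False
          then show ?thesis using 2 x step.hyps set_power_SucI by blast
        qed
      next
        case 3
        show ?thesis
        proof (cases "w = a")
          case True
          then show ?thesis using U_kill(1)[OF 3(1)] x by simp
        next
          case False
          then have "\<exists>j v. j \<ge> 1 \<and> v \<in> set_power A M j \<and> z = x \<otimes> v \<and> Suc (i + j) = Suc n"
            using x 3(2) by (intro exI[of _ 1] exI[of _ w]) simp
          then show ?thesis using 3(1) by blast
        qed
      next
        case 4
        have v: "v \<in> carrier A" using 4 set_power_closed[OF Mc] by blast
        show ?thesis
        proof (cases "w = a")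
          case True
          then show ?thesis using U_kill(2)[OF 4(1) v] x 4 by simp
        next
          case False
          then have "v \<otimes> w \<in> set_power A M (Suc j)" using x 4 set_power_SucI by blast
          moreover have "z = y \<otimes> (v \<otimes> w)" using x 4 v w U_closed[OF 4(1)] by (simp add: mult_assoc)
          ultimately have "\<exists>j v. j \<ge> 1 \<and> v \<in> set_power A M j \<and> z = y \<otimes> v \<and> Suc (i + j) = Suc n"
            using 4(5) by (intro exI[of _ "Suc j"] exI[of _ "v \<otimes> w"]) simp
          then show ?thesis using 4(1) by blast
        qed
      qed
    qed
    have CC: "C \<le> C * C" using C(1) by simp
    have K1: "C \<le> K" "C * C * (alg_norm A a / s) \<le> K"
      using CC C(1) na s0 by (auto simp: K_def distrib_left add_increasing)
    show "joint_spectral_radius A ({a} \<union> M) \<le> s"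
    proof (rule jsr_leI[OF aM, where C = K])
      fix n z assume n: "n \<ge> 1" and z: "z \<in> set_power A ({a} \<union> M) n"
      consider "z = \<zero>" | "z \<in> set_power A M n"
        | i where "z \<in> U i" "Suc i = n"
        | i y j v where "y \<in> U i" "j \<ge> 1" "v \<in> set_power A M j" "z = y \<otimes> v" "Suc (i + j) = n"
        using shape[OF n z] by blast
      then show "alg_norm A z \<le> K * s ^ n"
      proof cases
        case 1 then show ?thesis using K1 C(1) s0 by simp
      next
        case 2
        have "C * s ^ n \<le> K * s ^ n" using K1(1) s0 by (intro mult_right_mono) auto
        then show ?thesis using C(2)[OF n 2] by linarith
      next
        case 3
        have "alg_norm A z \<le> C * (alg_norm A a / s) * s ^ n"
          using U_norm[OF 3(1)] s0 by (simp add: 3(2)[symmetric] mult_ac)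
        also have "\<dots> \<le> C * C * (alg_norm A a / s) * s ^ n"
          using CC na s0 by (intro mult_right_mono) auto
        also have "\<dots> \<le> K * s ^ n" using K1 s0 by (intro mult_right_mono) auto
        finally show ?thesis .
      next
        case 4
        have v: "v \<in> carrier A" using 4 set_power_closed[OF Mc] by blast
        have "alg_norm A z \<le> alg_norm A y * alg_norm A v"
          using alg_norm_mult 4 v U_closed by blast
        also have "\<dots> \<le> (C * s ^ i * alg_norm A a) * (C * s ^ j)"
          using U_norm[OF 4(1)] C(2)[OF 4(2,3)] alg_norm_nonneg[OF v] C(1) s0 na
          by (intro mult_mono) auto
        also have "\<dots> = C * C * (alg_norm A a / s) * s ^ n"
          using s0 by (simp add: 4(5)[symmetric] power_add mult_ac)
        also have "\<dots> \<le> K * s ^ n" using K1 s0 by (intro mult_right_mono) auto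
        finally show ?thesis .
      qed
    qed (use s0 in simp)
  qed
  moreover have "joint_spectral_radius A M \<le> joint_spectral_radius A ({a} \<union> M)" if "M \<in> M_b A" for M
    using that insert_bounded[OF that a(1)] by (intro jsr_mono) (auto simp: M_b_def)
  ultimately show ?thesis
    using a unfolding R_b_def jsr_radical_def by (auto intro: antisym)
qed

lemma R_f_eq_carrier:
  assumes "\<And>M. M \<in> M_f A \<Longrightarrow> joint_spectral_radius A M = 0" shows "R_f A = carrier A"
proof -
  have "{a} \<union> M \<in> M_f A" if "M \<in> M_f A" "a \<in> carrier A" for a M
    using that by (auto simp: M_f_def)
  then show ?thesis using assms by (auto simp: R_f_def jsr_radical_def)
qed

lemma R_c_eq_carrier:
  assumes "\<And>M. M \<in> M_c A \<Longrightarrow> joint_spectral_radius A M = 0" shows "R_c A = carrier A"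
proof -
  have "{a} \<union> M \<in> M_c A" if "M \<in> M_c A" "a \<in> carrier A" for a M
  proof -
    have "mtotally_bounded ({a} \<union> M)"
      using that mtotally_bounded_Un[of "{a}" M] by (simp add: M_c_def)
    then show ?thesis using that by (simp add: M_c_def)
  qed
  then show ?thesis using assms by (auto simp: R_c_def jsr_radical_def)
qed

lemma null_sequence_precompact:
  assumes x: "\<And>i. x i \<in> carrier A" and lim: "(\<lambda>i. alg_norm A (x i)) \<longlonglongrightarrow> 0"
  shows "x ` {N..} \<in> M_c A"
  unfolding M_c_iff
proof (intro conjI allI impI)
  fix \<epsilon> :: real assume e: "0 < \<epsilon>"
  obtain n where n: "\<And>i. i \<ge> n \<Longrightarrow> alg_norm A (x i) < \<epsilon> / 2"
    using LIMSEQ_D[OF lim, of "\<epsilon> / 2"] e x alg_norm_nonneg by force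
  have self: "alg_norm A (x i \<oplus> (-1) \<odot> x i) = 0" for i
    using alg_dist_eq[OF x x, of i i] x mdist_zero by simp
  have "\<exists>b\<in>x ` {N..max N n}. alg_norm A (b \<oplus> (-1) \<odot> a) < \<epsilon>" if a: "a \<in> x ` {N..}" for a
  proof -
    obtain i where i: "a = x i" "i \<ge> N" using a by blast
    show ?thesis
    proof (cases "i \<le> max N n")
      case True
      then show ?thesis using i self[of i] e by (intro bexI[of _ "x i"]) auto
    next
      case False
      have "alg_norm A (x (max N n) \<oplus> (-1) \<odot> x i) \<le> alg_norm A (x (max N n)) + alg_norm A ((-1) \<odot> x i)"
        using x by (intro alg_norm_triangle) auto
      also have "alg_norm A ((-1) \<odot> x i) = alg_norm A (x i)" using x by (simp add: alg_norm_smult)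
      also have "alg_norm A (x (max N n)) + alg_norm A (x i) < \<epsilon>" using n[of "max N n"] n[of i] False by fastforce
      finally show ?thesis using i by auto
    qed
  qed
  then show "\<exists>K. finite K \<and> K \<subseteq> x ` {N..} \<and> (\<forall>a\<in>x ` {N..}. \<exists>b\<in>K. alg_norm A (b \<oplus> (-1) \<odot> a) < \<epsilon>)"
    by (intro exI[of _ "x ` {N..max N n}"]) auto
qed (use x in auto)

end

lemma R_c_subset_R_f: "A \<in> NA \<Longrightarrow> R_c A \<subseteq> R_f A"
  using complex_normed_algebra.M_f_subset_M_c by (auto simp: NA_def R_c_def R_f_def jsr_radical_def)

lemma R_b_subset_R_c: "A \<in> NA \<Longrightarrow> R_b A \<subseteq> R_c A"
  using complex_normed_algebra.M_c_subset_M_b by (auto simp: NA_def R_c_def R_b_def jsr_radical_def)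

section \<open>Quotients by closed ideals\<close>

context complex_normed_algebra
begin

lemma alg_idealD:
  assumes "alg_ideal A I"
  shows "I \<subseteq> carrier A" "\<zero> \<in> I"
    and "\<lbrakk>i \<in> I; j \<in> I\<rbrakk> \<Longrightarrow> i \<oplus> j \<in> I" "i \<in> I \<Longrightarrow> c \<odot> i \<in> I"
    and "\<lbrakk>i \<in> I; x \<in> carrier A\<rbrakk> \<Longrightarrow> x \<otimes> i \<in> I" "\<lbrakk>i \<in> I; x \<in> carrier A\<rbrakk> \<Longrightarrow> i \<otimes> x \<in> I"
proof -
  have sub: "submodule I complex_ring A" using assms by (simp add: alg_ideal_def)
  show I: "I \<subseteq> carrier A" using submoduleE(1)[OF sub] .
  show sm: "i \<in> I \<Longrightarrow> c \<odot> i \<in> I" for i c using submoduleE(4)[OF sub, of c i] by simp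
  obtain i where "i \<in> I" using submoduleE(2)[OF sub] by blast
  then show "\<zero> \<in> I" using sm[of i 0] I by (simp add: subset_iff)
qed (use assms submoduleE(5) in \<open>auto simp: alg_ideal_def\<close>)

lemma alg_idealI:
  assumes "I \<subseteq> carrier A" "\<zero> \<in> I"
    and "\<And>i j. \<lbrakk>i \<in> I; j \<in> I\<rbrakk> \<Longrightarrow> i \<oplus> j \<in> I" "\<And>i c. i \<in> I \<Longrightarrow> c \<odot> i \<in> I"
    and "\<And>i x. \<lbrakk>i \<in> I; x \<in> carrier A\<rbrakk> \<Longrightarrow> x \<otimes> i \<in> I" "\<And>i x. \<lbrakk>i \<in> I; x \<in> carrier A\<rbrakk> \<Longrightarrow> i \<otimes> x \<in> I"
  shows "alg_ideal A I"
  unfolding alg_ideal_def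
proof (intro conjI submoduleI)
  show "\<ominus> i \<in> I" if "i \<in> I" for i
    using assms(4)[OF that, of "-1"] minus_eq[of i] assms(1) that by (simp add: subset_iff)
qed (use assms in auto)

end

text \<open>
  The identities \<open>q_add\<close>, \<open>q_smult\<close> and \<open>q_mult\<close> allow every inner application of the quotient map
  to be dropped; with them the algebra laws of the quotient reduce to those of \<open>A\<close>.
\<close>

locale closed_ideal_quotient = complex_normed_algebra A for A :: "'a nalg" (structure) +
  fixes I :: "'a set"
  assumes closed_ideal: "closed_alg_ideal A I"
begin

abbreviation q where "q \<equiv> quot_map A I"

lemma ideal: "alg_ideal A I"
  using closed_ideal by (simp add: closed_alg_ideal_def)

lemmas I = alg_idealD[OF ideal]

lemma I_carrier [simp]: "i \<in> I \<Longrightarrow> i \<in> carrier A"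
  using I(1) by blast

lemma coset_eq: "I +> x = {i \<oplus> x | i. i \<in> I}"
  by (auto simp: a_r_coset_def r_coset_def)

lemma q_rep:
  assumes "x \<in> carrier A" obtains i where "i \<in> I" "q x = i \<oplus> x"
proof -
  have "x \<in> I +> x" using I(2) assms by (auto simp: coset_eq intro!: exI[of _ \<zero>])
  then have "q x \<in> I +> x" unfolding quot_map_def by (rule someI)
  then show ?thesis using that by (auto simp: coset_eq)
qed

lemma q_closed [simp]: "x \<in> carrier A \<Longrightarrow> q x \<in> carrier A"
  by (rule q_rep) auto

lemma q_add_ideal:
  assumes "i \<in> I" "x \<in> carrier A" shows "q (i \<oplus> x) = q x"
proof -
  have "I +> (i \<oplus> x) = I +> x"
  proof (intro equalityI subsetI)
    fix z assume "z \<in> I +> (i \<oplus> x)"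
    then obtain j where "j \<in> I" "z = j \<oplus> (i \<oplus> x)" by (auto simp: coset_eq)
    then show "z \<in> I +> x"
      using assms I(3) by (auto simp: coset_eq M.a_assoc intro!: exI[of _ "j \<oplus> i"])
  next
    fix z assume "z \<in> I +> x"
    then obtain j where j: "j \<in> I" "z = j \<oplus> x" by (auto simp: coset_eq)
    have "z = (j \<oplus> \<ominus> i) \<oplus> (i \<oplus> x)"
      using j assms by (simp add: M.a_assoc M.r_neg1)
    moreover have "j \<oplus> \<ominus> i \<in> I" using j assms I(3,4) minus_eq[of i] by simp
    ultimately show "z \<in> I +> (i \<oplus> x)" unfolding coset_eq by blast
  qed
  then show ?thesis by (simp add: quot_map_def)
qed

lemma q_ideal: "i \<in> I \<Longrightarrow> q i = q \<zero>"
  using q_add_ideal[of i \<zero>] by simp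

lemma q_eq_zeroD:
  assumes "x \<in> carrier A" "q x = q \<zero>" shows "x \<in> I"
proof -
  obtain i where i: "i \<in> I" "q x = i \<oplus> x" using q_rep assms(1) by blast
  obtain j where j: "j \<in> I" "q \<zero> = j \<oplus> \<zero>" by (rule q_rep[OF M.zero_closed])
  have "i \<oplus> x = j" using i j assms by simp
  then have "x = (\<ominus> i) \<oplus> j" using i assms by (metis I_carrier M.r_neg1)
  then show ?thesis using i j I(3,4) minus_eq[of i] by simp
qed

lemma q_q [simp]: "x \<in> carrier A \<Longrightarrow> q (q x) = q x"
  by (rule q_rep[of x]) (auto simp: q_add_ideal)

lemma q_add:
  assumes "x \<in> carrier A" "y \<in> carrier A"
  shows "q (q x \<oplus> y) = q (x \<oplus> y)" "q (x \<oplus> q y) = q (x \<oplus> y)"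
proof -
  have *: "q (q x \<oplus> y) = q (x \<oplus> y)" if "x \<in> carrier A" "y \<in> carrier A" for x y
    by (rule q_rep[OF that(1)]) (use that in \<open>simp add: M.a_assoc q_add_ideal\<close>)
  show "q (q x \<oplus> y) = q (x \<oplus> y)" using * assms by blast
  show "q (x \<oplus> q y) = q (x \<oplus> y)" using *[of y x] assms by (simp add: M.a_comm)
qed

lemma q_smult: "x \<in> carrier A \<Longrightarrow> q (c \<odot> q x) = q (c \<odot> x)"
  by (rule q_rep[of x]) (auto simp: smult_r_distr q_add_ideal I(4))

lemma q_mult:
  assumes "x \<in> carrier A" "y \<in> carrier A"
  shows "q (q x \<otimes> y) = q (x \<otimes> y)" "q (x \<otimes> q y) = q (x \<otimes> y)"
proof -
  show "q (q x \<otimes> y) = q (x \<otimes> y)"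
    by (rule q_rep[OF assms(1)]) (use assms in \<open>simp add: distr_left q_add_ideal I(6) mult_closed\<close>)
  show "q (x \<otimes> q y) = q (x \<otimes> y)"
    by (rule q_rep[OF assms(2)]) (use assms in \<open>simp add: distr_right q_add_ideal I(5) mult_closed\<close>)
qed

abbreviation N where "N x \<equiv> INF i\<in>I. alg_norm A (x \<oplus> i)"

lemma N_le: "\<lbrakk>x \<in> carrier A; i \<in> I\<rbrakk> \<Longrightarrow> N x \<le> alg_norm A (x \<oplus> i)"
  by (rule cINF_lower) (auto intro!: bdd_belowI[where m = 0] simp: alg_norm_nonneg)

lemma N_ge: "(\<And>i. i \<in> I \<Longrightarrow> c \<le> alg_norm A (x \<oplus> i)) \<Longrightarrow> c \<le> N x"
  using I(2) by (intro cINF_greatest) auto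

lemma N_nonneg: "x \<in> carrier A \<Longrightarrow> 0 \<le> N x"
  by (rule N_ge) (simp add: alg_norm_nonneg)

lemma N_less:
  assumes "x \<in> carrier A" "N x < c" obtains i where "i \<in> I" "alg_norm A (x \<oplus> i) < c"
  using N_ge[of c x] assms(2) by (meson not_le)

lemma N_q: assumes "x \<in> carrier A" shows "N (q x) = N x"
proof (rule antisym)
  obtain j where j: "j \<in> I" "q x = j \<oplus> x" using q_rep[OF assms] .
  show "N (q x) \<le> N x"
  proof (rule N_ge)
    fix i assume i: "i \<in> I"
    have "q x \<oplus> (\<ominus> j \<oplus> i) = (j \<oplus> \<ominus> j) \<oplus> (x \<oplus> i)"
      using i j assms by (simp add: M.a_ac del: M.r_neg)
    then have "q x \<oplus> (\<ominus> j \<oplus> i) = x \<oplus> i" using i j assms by (simp add: M.r_neg)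
    moreover have "\<ominus> j \<oplus> i \<in> I" using i j I(3,4) minus_eq[of j] by simp
    ultimately show "N (q x) \<le> alg_norm A (x \<oplus> i)" using N_le[of "q x"] assms by fastforce
  qed
  show "N x \<le> N (q x)"
  proof (rule N_ge)
    fix i assume i: "i \<in> I"
    have "q x \<oplus> i = x \<oplus> (j \<oplus> i)" using i j assms by (simp add: M.a_ac)
    then show "N x \<le> alg_norm A (q x \<oplus> i)" using N_le[OF assms, of "j \<oplus> i"] i j I(3) by simp
  qed
qed

text \<open>
  This is where closedness of the ideal enters.
\<close>

lemma N_zero_iff: assumes "x \<in> carrier A" shows "N x = 0 \<longleftrightarrow> x \<in> I"
proof
  assume "N x = 0"
  have "\<exists>y\<in>I. alg_norm A (x \<oplus> (-1) \<odot> y) < \<epsilon>" if e: "\<epsilon> > 0" for \<epsilon>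
  proof -
    obtain i where i: "i \<in> I" "alg_norm A (x \<oplus> i) < \<epsilon>" using N_less[OF assms, of \<epsilon>] \<open>N x = 0\<close> e by auto
    have "(-1) \<odot> ((-1) \<odot> i) = i" using i(1) smult_assoc1[of "-1" "-1" i] by simp
    then show ?thesis using i I(4)[OF i(1), of "-1"] by (intro bexI[of _ "(-1) \<odot> i"]) auto
  qed
  then show "x \<in> I" using closed_ideal assms unfolding closed_alg_ideal_def closedin_iff by blast
next
  assume x: "x \<in> I"
  have "x \<oplus> (-1) \<odot> x = \<zero>" using assms minus_eq[of x] M.r_neg[of x] by simp
  then have "N x \<le> 0" using N_le[OF assms I(4)[OF x, of "-1"]] by simp
  then show "N x = 0" using N_nonneg[OF assms] by simp
qed

lemma N_triangle:
  assumes "x \<in> carrier A" "y \<in> carrier A" shows "N (x \<oplus> y) \<le> N x + N y"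
proof (rule field_le_epsilon)
  fix e :: real assume e: "0 < e"
  obtain i where i: "i \<in> I" "alg_norm A (x \<oplus> i) < N x + e / 2" using N_less[OF assms(1), of "N x + e / 2"] e by auto
  obtain j where j: "j \<in> I" "alg_norm A (y \<oplus> j) < N y + e / 2" using N_less[OF assms(2), of "N y + e / 2"] e by auto
  have "N (x \<oplus> y) \<le> alg_norm A (x \<oplus> y \<oplus> (i \<oplus> j))" using i j assms I(3) by (intro N_le) auto
  also have "x \<oplus> y \<oplus> (i \<oplus> j) = (x \<oplus> i) \<oplus> (y \<oplus> j)" using i j assms by (simp add: M.a_ac)
  also have "alg_norm A \<dots> \<le> alg_norm A (x \<oplus> i) + alg_norm A (y \<oplus> j)"
    using i j assms by (intro alg_norm_triangle) auto
  finally show "N (x \<oplus> y) \<le> N x + N y + e" using i j by simp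
qed

lemma N_smult:
  assumes "x \<in> carrier A" shows "N (c \<odot> x) = cmod c * N x"
proof (cases "c = 0")
  case True
  then show ?thesis using N_zero_iff[of \<zero>] I(2) assms by simp
next
  case False
  have le: "N (c \<odot> x) \<le> cmod c * N x" if c: "c \<noteq> 0" and x: "x \<in> carrier A" for c x
  proof -
    have "N (c \<odot> x) / cmod c \<le> N x"
    proof (rule N_ge)
      fix i assume i: "i \<in> I"
      have "N (c \<odot> x) \<le> alg_norm A (c \<odot> x \<oplus> c \<odot> i)" using i x I(4) by (intro N_le) auto
      also have "c \<odot> x \<oplus> c \<odot> i = c \<odot> (x \<oplus> i)" using i x by (simp add: smult_r_distr)
      finally show "N (c \<odot> x) / cmod c \<le> alg_norm A (x \<oplus> i)"
        using c i x by (simp add: alg_norm_smult field_simps)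
    qed
    then show ?thesis using c by (simp add: field_simps)
  qed
  have "inverse c \<odot> (c \<odot> x) = x" using smult_assoc1[of "inverse c" c x] False assms by simp
  then have "N x \<le> cmod (inverse c) * N (c \<odot> x)" using le[of "inverse c" "c \<odot> x"] False assms by simp
  then have "cmod c * N x \<le> N (c \<odot> x)" using False by (simp add: norm_inverse norm_divide field_simps)
  then show ?thesis using le[OF False assms] by simp
qed

lemma N_mult:
  assumes "x \<in> carrier A" "y \<in> carrier A" shows "N (x \<otimes> y) \<le> N x * N y"
proof -
  have xy: "N (x \<otimes> y) \<le> alg_norm A (x \<oplus> i) * alg_norm A (y \<oplus> j)" if i: "i \<in> I" and j: "j \<in> I" for i j
  proof -
    define k where "k = x \<otimes> j \<oplus> i \<otimes> (y \<oplus> j)"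
    have k: "k \<in> I" unfolding k_def using i j assms I(3,5,6) by auto
    have "(x \<oplus> i) \<otimes> (y \<oplus> j) = x \<otimes> y \<oplus> k"
      using i j assms by (simp add: k_def distr_left distr_right mult_closed M.a_ac)
    then show ?thesis
      using N_le[of "x \<otimes> y" k] alg_norm_mult[of "x \<oplus> i" "y \<oplus> j"] k i j assms by (simp add: mult_closed)
  qed
  have "N (x \<otimes> y) \<le> N x * alg_norm A (y \<oplus> j)" if j: "j \<in> I" for j
  proof (rule field_le_epsilon)
    fix e :: real assume e: "0 < e"
    define d where "d = alg_norm A (y \<oplus> j)"
    have d: "d \<ge> 0" using j assms by (simp add: d_def alg_norm_nonneg)
    obtain i where i: "i \<in> I" "alg_norm A (x \<oplus> i) < N x + e / (d + 1)"
      using N_less[OF assms(1), of "N x + e / (d + 1)"] e d by auto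
    have "N (x \<otimes> y) \<le> alg_norm A (x \<oplus> i) * d" using xy[OF i(1) j] by (simp add: d_def)
    also have "\<dots> \<le> (N x + e / (d + 1)) * d" using i d by (intro mult_right_mono) auto
    also have "\<dots> = N x * d + e * (d / (d + 1))" by (simp add: distrib_right)
    also have "\<dots> \<le> N x * d + e"
      using d e mult_left_le[of "d / (d + 1)" e] by (simp add: divide_le_eq)
    finally show "N (x \<otimes> y) \<le> N x * alg_norm A (y \<oplus> j) + e" by (simp add: d_def)
  qed
  note * = this
  show ?thesis
  proof (rule field_le_epsilon)
    fix e :: real assume e: "0 < e"
    define d where "d = N x"
    have d: "d \<ge> 0" using assms by (simp add: d_def N_nonneg)
    obtain j where j: "j \<in> I" "alg_norm A (y \<oplus> j) < N y + e / (d + 1)"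
      using N_less[OF assms(2), of "N y + e / (d + 1)"] e d by auto
    have "N (x \<otimes> y) \<le> d * alg_norm A (y \<oplus> j)" using *[OF j(1)] by (simp add: d_def)
    also have "\<dots> \<le> d * (N y + e / (d + 1))" using j d by (intro mult_left_mono) auto
    also have "\<dots> = d * N y + e * (d / (d + 1))" by (simp add: distrib_left)
    also have "\<dots> \<le> d * N y + e"
      using d e mult_left_le[of "d / (d + 1)" e] by (simp add: divide_le_eq)
    finally show "N (x \<otimes> y) \<le> N x * N y + e" by (simp add: d_def)
  qed
qed

lemma quot_nalg_sel [simp]:
  "carrier (quot_nalg A I) = q ` carrier A"
  "x \<otimes>\<^bsub>quot_nalg A I\<^esub> y = q (x \<otimes> y)"
  "x \<oplus>\<^bsub>quot_nalg A I\<^esub> y = q (x \<oplus> y)"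
  "\<zero>\<^bsub>quot_nalg A I\<^esub> = q \<zero>"
  "c \<odot>\<^bsub>quot_nalg A I\<^esub> x = q (c \<odot> x)"
  "alg_norm (quot_nalg A I) x = N x"
  by (simp_all add: quot_nalg_def)

theorem quotient_normed_algebra: "complex_normed_algebra (quot_nalg A I)"
proof (rule complex_normed_algebraI)
  show "complex_normed_algebra_axioms (quot_nalg A I)"
  proof
    fix x assume "x \<in> carrier (quot_nalg A I)"
    then obtain x' where x: "x' \<in> carrier A" "x = q x'" by auto
    show "(alg_norm (quot_nalg A I) x = 0) = (x = \<zero>\<^bsub>quot_nalg A I\<^esub>)"
      using x N_zero_iff[OF x(1)] q_eq_zeroD[OF x(1)] q_ideal[of x'] by (auto simp: N_q)
  qed (auto simp: q_mult q_add q_smult mult_closed N_q,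
      auto simp: mult_assoc distr_left distr_right smult_mult_left smult_mult_right
        N_nonneg N_triangle N_smult N_mult)
next
  fix c d x assume "x \<in> carrier (quot_nalg A I)"
  then have "x \<in> carrier A" by auto
  then show "(c + d) \<odot>\<^bsub>quot_nalg A I\<^esub> x = c \<odot>\<^bsub>quot_nalg A I\<^esub> x \<oplus>\<^bsub>quot_nalg A I\<^esub> d \<odot>\<^bsub>quot_nalg A I\<^esub> x"
    and "(c * d) \<odot>\<^bsub>quot_nalg A I\<^esub> x = c \<odot>\<^bsub>quot_nalg A I\<^esub> (d \<odot>\<^bsub>quot_nalg A I\<^esub> x)"
    using smult_l_distr[of c d x] smult_assoc1[of c d x] by (simp_all add: q_add q_smult)
qed (auto simp: q_add q_smult smult_r_distr, simp_all add: M.a_ac)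

end

lemma R_bI:
  assumes "x \<in> carrier A"
    and "\<And>M. M \<in> M_b A \<Longrightarrow> joint_spectral_radius A ({x} \<union> M) = joint_spectral_radius A M"
  shows "x \<in> R_b A"
  using assms by (simp add: R_b_def jsr_radical_def)

text \<open>
  The second axiom fails: if \<open>R_b A\<close> contains all products, then \<open>A / R_b A\<close> has zero
  multiplication, so it coincides with its own \<open>R_b\<close>; and it is nonzero.
\<close>

lemma not_topological_radicalI:
  fixes A :: "'a nalg"
  assumes A: "A \<in> BA" and proper: "R_b A \<noteq> carrier A"
    and prods: "\<And>x y. \<lbrakk>closed_alg_ideal A (R_b A); x \<in> carrier A; y \<in> carrier A\<rbrakk>
      \<Longrightarrow> x \<otimes>\<^bsub>A\<^esub> y \<in> R_b A"
  shows "\<not> topological_radical (R_b :: 'a nalg \<Rightarrow> 'a set)"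
proof
  assume "topological_radical (R_b :: 'a nalg \<Rightarrow> 'a set)"
  note R = this[unfolded topological_radical_def]
  have cl: "closed_alg_ideal A (R_b A)" using conjunct1[OF R] A by (rule bspec)
  have Q: "R_b (quot_nalg A (R_b A)) = {\<zero>\<^bsub>quot_nalg A (R_b A)\<^esub>}"
    using conjunct1[OF conjunct2[OF conjunct2[OF R]]] A by (rule bspec)
  interpret complex_normed_algebra A using A by (simp add: BA_def NA_def)
  interpret closed_ideal_quotient A "R_b A" by unfold_locales (rule cl)
  interpret Q: complex_normed_algebra "quot_nalg A (R_b A)" by (rule quotient_normed_algebra)
  have null: "x \<otimes>\<^bsub>quot_nalg A (R_b A)\<^esub> y = \<zero>\<^bsub>quot_nalg A (R_b A)\<^esub>"
    if "x \<in> carrier (quot_nalg A (R_b A))" "y \<in> carrier (quot_nalg A (R_b A))" for x y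
    using that prods[OF cl] q_ideal by (auto simp: q_mult)
  have zero: "joint_spectral_radius (quot_nalg A (R_b A)) M = 0"
    if M: "M \<in> M_b (quot_nalg A (R_b A))" for M
  proof (rule Q.jsr_square_zero[OF M])
    have "M \<subseteq> carrier (quot_nalg A (R_b A))" using M unfolding Q.M_b_iff by blast
    then show "a \<otimes>\<^bsub>quot_nalg A (R_b A)\<^esub> b = \<zero>\<^bsub>quot_nalg A (R_b A)\<^esub>" if "a \<in> M" "b \<in> M" for a b
      using that null by blast
  qed
  have "x \<in> R_b (quot_nalg A (R_b A))" if "x \<in> carrier (quot_nalg A (R_b A))" for x
    using that zero zero[OF Q.insert_bounded[OF _ that]] by (intro R_bI) simp_all
  moreover have "carrier A \<noteq> R_b A" "R_b A \<subseteq> carrier A" using proper I(1) by auto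
  then obtain x where x: "x \<in> carrier A" "x \<notin> R_b A" by auto
  ultimately have "q x \<in> R_b (quot_nalg A (R_b A))" by simp
  then have "q x = q \<zero>\<^bsub>A\<^esub>" unfolding Q by simp
  then show False using q_eq_zeroD[OF x(1)] x(2) by simp
qed

section \<open>Isomorphic copies on another type\<close>

text \<open>
  The examples live on a function space; an isometric copy carries them over to any type into which
  that space can be embedded. The operations are defined through \<open>inv_into\<close>, so that on values of \<open>h\<close> they
  agree with those of \<open>A\<close> without any closure condition.
\<close>

definition transport :: "('a \<Rightarrow> 'b) \<Rightarrow> 'a nalg \<Rightarrow> 'b nalg" where
  "transport h A = \<lparr>
     carrier = h ` carrier A,
     monoid.mult = (\<lambda>x y. h (inv_into UNIV h x \<otimes>\<^bsub>A\<^esub> inv_into UNIV h y)),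
     one = h \<one>\<^bsub>A\<^esub>,
     ring.zero = h \<zero>\<^bsub>A\<^esub>,
     add = (\<lambda>x y. h (inv_into UNIV h x \<oplus>\<^bsub>A\<^esub> inv_into UNIV h y)),
     smult = (\<lambda>c x. h (c \<odot>\<^bsub>A\<^esub> inv_into UNIV h x)),
     alg_norm = (\<lambda>x. alg_norm A (inv_into UNIV h x)) \<rparr>"

locale transported = complex_normed_algebra A for A :: "'a nalg" (structure) +
  fixes h :: "'a \<Rightarrow> 'b"
  assumes inj: "inj h"
begin

abbreviation B where "B \<equiv> transport h A"

lemma transport_sel [simp]:
  "carrier B = h ` carrier A"
  "h x \<otimes>\<^bsub>B\<^esub> h y = h (x \<otimes> y)"
  "h x \<oplus>\<^bsub>B\<^esub> h y = h (x \<oplus> y)"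
  "\<zero>\<^bsub>B\<^esub> = h \<zero>"
  "c \<odot>\<^bsub>B\<^esub> h x = h (c \<odot> x)"
  "alg_norm B (h x) = alg_norm A x"
  by (simp_all add: transport_def inj)

lemma h_eq_iff [simp]: "h x = h y \<longleftrightarrow> x = y"
  using inj by (simp add: inj_eq)

lemma image_carrierE:
  assumes "M \<subseteq> carrier B" obtains N where "N \<subseteq> carrier A" "M = h ` N"
  using assms by (auto simp: subset_image_iff)

sublocale B: complex_normed_algebra B
proof (rule complex_normed_algebraI)
  show "complex_normed_algebra_axioms B"
    by standard (auto simp: mult_closed mult_assoc distr_left distr_right smult_mult_left
      smult_mult_right alg_norm_nonneg alg_norm_eq_0 alg_norm_triangle alg_norm_smult alg_norm_mult)
next
  fix c d x assume "x \<in> carrier B"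
  then show "(c + d) \<odot>\<^bsub>B\<^esub> x = c \<odot>\<^bsub>B\<^esub> x \<oplus>\<^bsub>B\<^esub> d \<odot>\<^bsub>B\<^esub> x" and "(c * d) \<odot>\<^bsub>B\<^esub> x = c \<odot>\<^bsub>B\<^esub> (d \<odot>\<^bsub>B\<^esub> x)"
    using smult_l_distr[of c d] smult_assoc1[of c d] by auto
qed (auto simp: M.a_ac smult_r_distr)

lemma set_power_transport: "set_power B (h ` M) n = h ` set_power A M n"
proof (induction n)
  case (Suc n)
  then show ?case by (cases n) (auto simp: set_mult_def)
qed simp

lemma jsr_transport: "joint_spectral_radius B (h ` M) = joint_spectral_radius A M"
  by (simp add: joint_spectral_radius_def set_power_transport set_norm_def image_image)

lemma jsr_radical_transport:
  assumes "\<And>M. M \<in> \<N> B \<Longrightarrow> M \<subseteq> carrier B" and "\<And>M. M \<in> \<M> A \<Longrightarrow> M \<subseteq> carrier A"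
    and "\<And>M. M \<subseteq> carrier A \<Longrightarrow> h ` M \<in> \<N> B \<longleftrightarrow> M \<in> \<M> A"
  shows "jsr_radical \<N> B = h ` jsr_radical \<M> A"
proof -
  have *: "(\<forall>M\<in>\<N> B. joint_spectral_radius B ({h a} \<union> M) = joint_spectral_radius B M) \<longleftrightarrow>
      (\<forall>M\<in>\<M> A. joint_spectral_radius A ({a} \<union> M) = joint_spectral_radius A M)" for a
  proof -
    have eq: "joint_spectral_radius B (insert (h a) (h ` M)) = joint_spectral_radius A (insert a M)" for M
      using jsr_transport[of "insert a M"] by simp
    have "\<N> B = (`) h ` \<M> A"
    proof (intro equalityI subsetI)
      fix M assume M: "M \<in> \<N> B"
      obtain N where N: "N \<subseteq> carrier A" "M = h ` N" by (rule image_carrierE[OF assms(1)[OF M]])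
      then have "N \<in> \<M> A" using assms(3)[of N] M by simp
      then show "M \<in> (`) h ` \<M> A" using N by blast
    next
      fix M assume "M \<in> (`) h ` \<M> A"
      then obtain N where "N \<in> \<M> A" "M = h ` N" by blast
      then show "M \<in> \<N> B" using assms(2,3)[of N] by simp
    qed
    then show ?thesis by (simp add: eq jsr_transport)
  qed
  show ?thesis unfolding jsr_radical_def using * by auto
qed

lemma M_f_transport: "M \<subseteq> carrier A \<Longrightarrow> h ` M \<in> M_f B \<longleftrightarrow> M \<in> M_f A"
  using inj by (auto simp: M_f_def finite_image_iff inj_on_def)

lemma M_c_transport: "M \<subseteq> carrier A \<Longrightarrow> h ` M \<in> M_c B \<longleftrightarrow> M \<in> M_c A"
proof -
  assume M: "M \<subseteq> carrier A"
  have "(\<exists>K. finite K \<and> K \<subseteq> h ` M \<and> (\<forall>a\<in>h ` M. \<exists>b\<in>K. alg_norm B (b \<oplus>\<^bsub>B\<^esub> (-1) \<odot>\<^bsub>B\<^esub> a) < e)) \<longleftrightarrow>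
      (\<exists>K. finite K \<and> K \<subseteq> M \<and> (\<forall>a\<in>M. \<exists>b\<in>K. alg_norm A (b \<oplus> (-1) \<odot> a) < e))" for e
    unfolding ex_finite_subset_image by simp
  then show ?thesis unfolding M_c_iff B.M_c_iff by (simp only:) (use M in auto)
qed

lemma M_b_transport: "M \<subseteq> carrier A \<Longrightarrow> h ` M \<in> M_b B \<longleftrightarrow> M \<in> M_b A"
  unfolding M_b_iff B.M_b_iff by auto

lemma R_f_transport: "R_f B = h ` R_f A"
  unfolding R_f_def using M_f_transport by (intro jsr_radical_transport) (auto simp: M_f_def)

lemma R_c_transport: "R_c B = h ` R_c A"
  unfolding R_c_def using M_c_transport by (intro jsr_radical_transport) (auto simp: M_c_def)

lemma R_b_transport: "R_b B = h ` R_b A"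
  unfolding R_b_def using M_b_transport by (intro jsr_radical_transport) (auto simp: M_b_def)

lemma NA_transport: "B \<in> NA"
  by (simp add: NA_def B.complex_normed_algebra_axioms)

lemma BA_transport: assumes "A \<in> BA" shows "B \<in> BA"
proof -
  have compl: "\<exists>x\<in>carrier A. \<forall>\<epsilon>>0. \<exists>N. \<forall>n\<ge>N. alg_norm A (f n \<oplus> (-1) \<odot> x) < \<epsilon>"
    if "range f \<subseteq> carrier A"
      "\<forall>\<epsilon>>0. \<exists>N. \<forall>m\<ge>N. \<forall>n\<ge>N. alg_norm A (f m \<oplus> (-1) \<odot> f n) < \<epsilon>" for f :: "nat \<Rightarrow> 'a"
    using assms that mcomplete_iff by (auto simp: BA_def)
  have "B.mcomplete"
    unfolding B.mcomplete_iff
  proof (intro allI impI)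
    fix g :: "nat \<Rightarrow> 'b"
    assume g: "range g \<subseteq> carrier B"
      and cau: "\<forall>\<epsilon>>0. \<exists>N. \<forall>m\<ge>N. \<forall>n\<ge>N. alg_norm B (g m \<oplus>\<^bsub>B\<^esub> (-1) \<odot>\<^bsub>B\<^esub> g n) < \<epsilon>"
    have "\<forall>n. \<exists>x. x \<in> carrier A \<and> g n = h x" using g by auto
    then obtain f where f: "\<And>n. f n \<in> carrier A" "\<And>n. g n = h (f n)" by metis
    obtain x where "x \<in> carrier A" "\<forall>\<epsilon>>0. \<exists>N. \<forall>n\<ge>N. alg_norm A (f n \<oplus> (-1) \<odot> x) < \<epsilon>"
      using compl[of f] f cau by auto
    then show "\<exists>x\<in>carrier B. \<forall>\<epsilon>>0. \<exists>N. \<forall>n\<ge>N. alg_norm B (g n \<oplus>\<^bsub>B\<^esub> (-1) \<odot>\<^bsub>B\<^esub> x) < \<epsilon>"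
      using f by auto
  qed
  then show ?thesis using NA_transport by (simp add: BA_def)
qed

lemma closed_alg_ideal_transport:
  assumes "closed_alg_ideal B (h ` I)" shows "closed_alg_ideal A I"
proof -
  have id: "alg_ideal B (h ` I)" and cl: "closedin B.mtopology (h ` I)"
    using assms by (auto simp: closed_alg_ideal_def)
  have "alg_ideal A I"
  proof (rule alg_idealI)
    show "I \<subseteq> carrier A" using B.alg_idealD(1)[OF id] by auto
    show "\<zero> \<in> I" using B.alg_idealD(2)[OF id] by auto
    fix i assume i: "i \<in> I"
    show "c \<odot> i \<in> I" for c using B.alg_idealD(4)[OF id, of "h i" c] i by auto
    show "i \<oplus> j \<in> I" if "j \<in> I" for j using B.alg_idealD(3)[OF id, of "h i" "h j"] i that by auto
    show "x \<otimes> i \<in> I" "i \<otimes> x \<in> I" if "x \<in> carrier A" for x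
      using B.alg_idealD(5,6)[OF id, of "h i" "h x"] i that by auto
  qed
  moreover have "closedin mtopology I"
    unfolding closedin_iff
  proof (intro conjI ballI impI)
    show "I \<subseteq> carrier A" using B.alg_idealD(1)[OF id] by auto
    fix x assume "x \<in> carrier A" and "\<forall>\<epsilon>>0. \<exists>y\<in>I. alg_norm A (x \<oplus> (-1) \<odot> y) < \<epsilon>"
    then have "h x \<in> carrier B"
      "\<forall>\<epsilon>>0. \<exists>y\<in>h ` I. alg_norm B (h x \<oplus>\<^bsub>B\<^esub> (-1) \<odot>\<^bsub>B\<^esub> y) < \<epsilon>" by auto
    then have "h x \<in> h ` I" using cl unfolding B.closedin_iff by blast
    then show "x \<in> I" by auto
  qed
  ultimately show ?thesis by (simp add: closed_alg_ideal_def)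
qed

end

section \<open>Subalgebras\<close>

lemma set_power_sub_nalg: "set_power (sub_nalg A S) M n = set_power A M n"
proof (induction n)
  case (Suc n)
  then show ?case by (cases n) (auto simp: set_mult_def)
qed simp

lemma jsr_sub_nalg: "joint_spectral_radius (sub_nalg A S) M = joint_spectral_radius A M"
  by (simp add: joint_spectral_radius_def set_power_sub_nalg set_norm_def)

lemma (in complex_normed_algebra) subalgebra:
  assumes "S \<subseteq> carrier A" "\<zero> \<in> S" "\<And>x y. \<lbrakk>x \<in> S; y \<in> S\<rbrakk> \<Longrightarrow> x \<oplus> y \<in> S"
    "\<And>c x. x \<in> S \<Longrightarrow> c \<odot> x \<in> S" "\<And>x y. \<lbrakk>x \<in> S; y \<in> S\<rbrakk> \<Longrightarrow> x \<otimes> y \<in> S"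
  shows "complex_normed_algebra (sub_nalg A S)"
proof (rule complex_normed_algebraI)
  have S: "x \<in> carrier A" if "x \<in> S" for x using assms(1) that by blast
  show "complex_normed_algebra_axioms (sub_nalg A S)"
    by standard (auto simp: S assms(5) mult_assoc distr_left distr_right smult_mult_left smult_mult_right
        alg_norm_nonneg alg_norm_eq_0 alg_norm_triangle alg_norm_smult alg_norm_mult)
  fix c d x assume "x \<in> carrier (sub_nalg A S)"
  then have "x \<in> carrier A" using S by simp
  then show "(c + d) \<odot>\<^bsub>sub_nalg A S\<^esub> x = c \<odot>\<^bsub>sub_nalg A S\<^esub> x \<oplus>\<^bsub>sub_nalg A S\<^esub> d \<odot>\<^bsub>sub_nalg A S\<^esub> x"
    and "(c * d) \<odot>\<^bsub>sub_nalg A S\<^esub> x = c \<odot>\<^bsub>sub_nalg A S\<^esub> (d \<odot>\<^bsub>sub_nalg A S\<^esub> x)"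
    using smult_l_distr[of c d x] smult_assoc1[of c d x] by simp_all
qed (use assms in \<open>auto simp: subset_iff smult_r_distr, simp_all add: M.a_ac\<close>)

section \<open>Algebras of words\<close>

text \<open>
  Convolution over all ways to cut a word in two. The cuts with an empty half contribute nothing,
  because the elements of the algebra vanish at the empty word.
\<close>

definition word_conv :: "'l list set \<Rightarrow> ('l list \<Rightarrow> complex) \<Rightarrow> ('l list \<Rightarrow> complex) \<Rightarrow> 'l list \<Rightarrow> complex"
  where "word_conv W f g w = (if w \<in> W then \<Sum>k\<le>length w. f (take k w) * g (drop k w) else 0)"

definition word_alg :: "'l list set \<Rightarrow> ('l list \<Rightarrow> complex) nalg" where
  "word_alg W = \<lparr>
     carrier = {f. (\<forall>w. w \<notin> W \<longrightarrow> f w = 0) \<and> (\<lambda>w. cmod (f w)) summable_on UNIV},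
     monoid.mult = word_conv W,
     one = (\<lambda>_. 0),
     ring.zero = (\<lambda>_. 0),
     add = (\<lambda>f g w. f w + g w),
     smult = (\<lambda>c f w. c * f w),
     alg_norm = (\<lambda>f. \<Sum>\<^sub>\<infinity>w. cmod (f w)) \<rparr>"

lemma word_alg_sel [simp]:
  "carrier (word_alg W) = {f. (\<forall>w. w \<notin> W \<longrightarrow> f w = 0) \<and> (\<lambda>w. cmod (f w)) summable_on UNIV}"
  "f \<otimes>\<^bsub>word_alg W\<^esub> g = word_conv W f g"
  "\<zero>\<^bsub>word_alg W\<^esub> = (\<lambda>_. 0)"
  "f \<oplus>\<^bsub>word_alg W\<^esub> g = (\<lambda>w. f w + g w)"
  "c \<odot>\<^bsub>word_alg W\<^esub> f = (\<lambda>w. c * f w)"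
  "alg_norm (word_alg W) f = (\<Sum>\<^sub>\<infinity>w. cmod (f w))"
  by (simp_all add: word_alg_def)

lemma nonpos_if_le_small_multiples:
  fixes x C :: real
  assumes "\<And>t. \<lbrakk>0 < t; t < 1\<rbrakk> \<Longrightarrow> x \<le> t * C" shows "x \<le> 0"
proof (rule tendsto_lowerbound)
  show "((\<lambda>t. t * C) \<longlongrightarrow> 0) (at_right 0)" by (auto intro!: tendsto_eq_intros)
  show "\<forall>\<^sub>F t in at_right 0. x \<le> t * C"
    using assms by (auto simp: eventually_at_right_field intro!: exI[of _ 1])
qed simp

lemma nonneg_summable_boundedI:
  fixes p :: "'a \<Rightarrow> real"
  assumes "\<And>x. 0 \<le> p x" "\<And>F. finite F \<Longrightarrow> sum p F \<le> C"
  shows "p summable_on UNIV" "infsum p UNIV \<le> C"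
proof -
  show s: "p summable_on UNIV"
    by (rule nonneg_bdd_above_summable_on) (use assms in \<open>auto intro!: bdd_aboveI2\<close>)
  show "infsum p UNIV \<le> C" by (rule infsum_le_finite_sums[OF s]) (use assms in auto)
qed

text \<open>
  A word together with a cutting point is determined by its two halves, so the left-hand side is
  part of the double sum on the right.
\<close>

lemma sum_splits_le:
  fixes p r :: "'l list \<Rightarrow> real"
  assumes p: "\<And>w. 0 \<le> p w" "p summable_on UNIV" and r: "\<And>w. 0 \<le> r w" "r summable_on UNIV"
    and F: "finite F"
  shows "(\<Sum>w\<in>F. \<Sum>k\<le>length w. p (take k w) * r (drop k w)) \<le> infsum p UNIV * infsum r UNIV"
proof -
  define S where "S = (SIGMA w:F. {..length w})"
  define \<phi> where "\<phi> = (\<lambda>(w, k). (take k w, drop k w) :: 'l list \<times> 'l list)"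
  have fin: "finite S" using F by (simp add: S_def)
  have inj: "inj_on \<phi> S"
  proof (rule inj_onI)
    fix x y assume x: "x \<in> S" and y: "y \<in> S" and eq: "\<phi> x = \<phi> y"
    obtain v j where v: "x = (v, j)" "j \<le> length v" using x by (auto simp: S_def)
    obtain w k where w: "y = (w, k)" "k \<le> length w" using y by (auto simp: S_def)
    have e: "take j v = take k w" "drop j v = drop k w" using eq v w by (auto simp: \<phi>_def)
    have "v = w" using append_take_drop_id[of j v] append_take_drop_id[of k w] e by metis
    moreover have "j = k" using arg_cong[OF e(1), of length] v w by simp
    ultimately show "x = y" using v w by simp
  qed
  have "(\<Sum>w\<in>F. \<Sum>k\<le>length w. p (take k w) * r (drop k w)) = (\<Sum>x\<in>S. case \<phi> x of (u, v) \<Rightarrow> p u * r v)"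
    using F by (simp add: S_def \<phi>_def sum.Sigma split_beta)
  also have "\<dots> = (\<Sum>(u, v)\<in>\<phi> ` S. p u * r v)"
    by (simp add: sum.reindex[OF inj])
  also have "\<dots> \<le> (\<Sum>(u, v)\<in>(fst ` \<phi> ` S) \<times> (snd ` \<phi> ` S). p u * r v)"
  proof (rule sum_mono2)
    show "\<phi> ` S \<subseteq> (fst ` \<phi> ` S) \<times> (snd ` \<phi> ` S)" by (rule subset_fst_snd)
  qed (use fin p r in auto)
  also have "\<dots> = (\<Sum>u\<in>fst ` \<phi> ` S. p u) * (\<Sum>v\<in>snd ` \<phi> ` S. r v)"
    by (simp add: sum_product sum.cartesian_product)
  also have "\<dots> \<le> infsum p UNIV * infsum r UNIV"
    using fin p r
    by (intro mult_mono finite_sum_le_infsum sum_nonneg infsum_nonneg) auto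
  finally show ?thesis .
qed

text \<open>
  For \<open>\<omega> = 1\<close> this is submultiplicativity of the norm; other weights give the equivalent norms used
  to bound joint spectral radii.
\<close>

lemma word_conv_weighted_le:
  assumes w: "\<And>w. 0 \<le> \<omega> w" "\<And>u v. \<omega> (u @ v) \<le> \<omega> u * \<omega> v"
    and f: "(\<lambda>w. \<omega> w * cmod (f w)) summable_on UNIV" and g: "(\<lambda>w. \<omega> w * cmod (g w)) summable_on UNIV"
  shows "(\<lambda>w. \<omega> w * cmod (word_conv W f g w)) summable_on UNIV"
    and "(\<Sum>\<^sub>\<infinity>w. \<omega> w * cmod (word_conv W f g w))
      \<le> (\<Sum>\<^sub>\<infinity>w. \<omega> w * cmod (f w)) * (\<Sum>\<^sub>\<infinity>w. \<omega> w * cmod (g w))"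
proof -
  have pt: "\<omega> x * cmod (word_conv W f g x)
      \<le> (\<Sum>k\<le>length x. (\<omega> (take k x) * cmod (f (take k x))) * (\<omega> (drop k x) * cmod (g (drop k x))))" for x
  proof -
    have "cmod (word_conv W f g x) \<le> (\<Sum>k\<le>length x. cmod (f (take k x)) * cmod (g (drop k x)))"
    proof (cases "x \<in> W")
      case True
      then show ?thesis unfolding word_conv_def by (auto intro!: sum_norm_le simp: norm_mult)
    qed (simp add: word_conv_def sum_nonneg)
    then have "\<omega> x * cmod (word_conv W f g x)
        \<le> (\<Sum>k\<le>length x. \<omega> x * (cmod (f (take k x)) * cmod (g (drop k x))))"
      unfolding sum_distrib_left[symmetric] using w(1) by (rule mult_left_mono)
    also have "\<dots> \<le> (\<Sum>k\<le>length x. (\<omega> (take k x) * \<omega> (drop k x)) * (cmod (f (take k x)) * cmod (g (drop k x))))"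
    proof (intro sum_mono mult_right_mono)
      show "\<omega> x \<le> \<omega> (take k x) * \<omega> (drop k x)" for k using w(2)[of "take k x" "drop k x"] by simp
    qed simp
    finally show ?thesis by (simp add: mult_ac)
  qed
  have fin: "(\<Sum>x\<in>F. \<omega> x * cmod (word_conv W f g x))
      \<le> (\<Sum>\<^sub>\<infinity>w. \<omega> w * cmod (f w)) * (\<Sum>\<^sub>\<infinity>w. \<omega> w * cmod (g w))" if "finite F" for F
    by (rule order_trans[OF sum_mono[OF pt] sum_splits_le[OF _ f _ g that]]) (use w in auto)
  show "(\<lambda>w. \<omega> w * cmod (word_conv W f g w)) summable_on UNIV"
    "(\<Sum>\<^sub>\<infinity>w. \<omega> w * cmod (word_conv W f g w))
      \<le> (\<Sum>\<^sub>\<infinity>w. \<omega> w * cmod (f w)) * (\<Sum>\<^sub>\<infinity>w. \<omega> w * cmod (g w))"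
    using nonneg_summable_boundedI[OF _ fin] w by simp_all
qed

lemma norm_triangle_l1:
  fixes f g :: "'l list \<Rightarrow> complex"
  assumes "(\<lambda>w. cmod (f w)) summable_on UNIV" "(\<lambda>w. cmod (g w)) summable_on UNIV"
  shows "(\<lambda>w. cmod (f w + g w)) summable_on UNIV"
    "(\<Sum>\<^sub>\<infinity>w. cmod (f w + g w)) \<le> (\<Sum>\<^sub>\<infinity>w. cmod (f w)) + (\<Sum>\<^sub>\<infinity>w. cmod (g w))"
proof -
  have s: "(\<lambda>w. cmod (f w) + cmod (g w)) summable_on UNIV" using assms by (rule summable_on_add)
  show c: "(\<lambda>w. cmod (f w + g w)) summable_on UNIV"
    by (rule summable_on_comparison_test[OF s]) (auto simp: norm_triangle_ineq)
  show "(\<Sum>\<^sub>\<infinity>w. cmod (f w + g w)) \<le> (\<Sum>\<^sub>\<infinity>w. cmod (f w)) + (\<Sum>\<^sub>\<infinity>w. cmod (g w))"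
    unfolding infsum_add[OF assms, symmetric] by (rule infsum_mono[OF c s]) (simp add: norm_triangle_ineq)
qed

lemma l1_zeroD:
  assumes "(\<lambda>w. cmod (f w)) summable_on UNIV" "(\<Sum>\<^sub>\<infinity>w. cmod (f w)) = 0"
  shows "f = (\<lambda>_. 0)"
proof
  fix w show "f w = 0"
    using finite_sum_le_infsum[OF assms(1), of "{w}"] assms(2) by simp
qed

text \<open>
  Closure under factors makes the product associative: if a word of \<open>W\<close> is cut into three pieces,
  then the partial products from either bracketing stay in \<open>W\<close>. Without the empty word
  there is no unit, so that radicals can be large.
\<close>

locale word_system =
  fixes W :: "'l list set"
  assumes nonempty: "[] \<notin> W"
    and factor: "\<lbrakk>u @ v @ w \<in> W; v \<noteq> []\<rbrakk> \<Longrightarrow> v \<in> W"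
begin

abbreviation A where "A \<equiv> word_alg W"

lemma take_in: "\<lbrakk>w \<in> W; take k w \<noteq> []\<rbrakk> \<Longrightarrow> take k w \<in> W"
  using factor[of "[]" "take k w" "drop k w"] by simp

lemma drop_in: "\<lbrakk>w \<in> W; drop k w \<noteq> []\<rbrakk> \<Longrightarrow> drop k w \<in> W"
  using factor[of "take k w" "drop k w" "[]"] by simp

lemma conv_factor:
  assumes "u \<in> W \<or> u = []" "f [] = 0"
  shows "word_conv W f g u = (\<Sum>k\<le>length u. f (take k u) * g (drop k u))"
  using assms nonempty by (auto simp: word_conv_def)

lemma word_conv_assoc:
  assumes f: "f [] = 0" and g: "g [] = 0"
  shows "word_conv W (word_conv W f g) h = word_conv W f (word_conv W g h)"
proof
  fix w
  show "word_conv W (word_conv W f g) h w = word_conv W f (word_conv W g h) w"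
  proof (cases "w \<in> W")
    case True
    let ?n = "length w"
    define T where "T = (\<lambda>(i::nat) (j::nat) (k::nat). f (take i w) * g (take j (drop i w)) * h (drop (i + j) w))"
    have "word_conv W (word_conv W f g) h w = (\<Sum>k\<le>?n. word_conv W f g (take k w) * h (drop k w))"
      using True by (simp add: word_conv_def)
    also have "\<dots> = (\<Sum>k\<le>?n. \<Sum>i\<le>k. T i (k - i) (?n - k))"
    proof (rule sum.cong[OF refl])
      fix k assume k: "k \<in> {..?n}"
      have "take k w \<in> W \<or> take k w = []" using take_in[OF True] by blast
      then have "word_conv W f g (take k w)
          = (\<Sum>i\<le>length (take k w). f (take i (take k w)) * g (drop i (take k w)))"
        using f by (rule conv_factor)
      also have "\<dots> = (\<Sum>i\<le>k. f (take i w) * g (take (k - i) (drop i w)))"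
        using k by (intro sum.cong) (auto simp: drop_take min_def)
      finally show "word_conv W f g (take k w) * h (drop k w) = (\<Sum>i\<le>k. T i (k - i) (?n - k))"
        by (simp add: T_def sum_distrib_right)
    qed
    also have "\<dots> = (\<Sum>i\<le>?n. \<Sum>j\<le>?n - i. T i j (?n - i - j))"
      using fps_mult_assoc_lemma[where k = ?n and f = T] by (simp add: atMost_atLeast0)
    also have "\<dots> = (\<Sum>i\<le>?n. f (take i w) * word_conv W g h (drop i w))"
    proof (rule sum.cong[OF refl])
      fix i assume i: "i \<in> {..?n}"
      have "drop i w \<in> W \<or> drop i w = []" using drop_in[OF True] by blast
      then have "word_conv W g h (drop i w)
          = (\<Sum>j\<le>length (drop i w). g (take j (drop i w)) * h (drop j (drop i w)))"
        using g by (rule conv_factor)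
      then show "(\<Sum>j\<le>?n - i. T i j (?n - i - j)) = f (take i w) * word_conv W g h (drop i w)"
        by (simp add: T_def sum_distrib_left mult.assoc add.commute)
    qed
    also have "\<dots> = word_conv W f (word_conv W g h) w"
      using True by (simp add: word_conv_def)
    finally show ?thesis .
  qed (simp add: word_conv_def)
qed

lemma word_algebra: "complex_normed_algebra A"
proof (rule complex_normed_algebraI)
  show "complex_normed_algebra_axioms A"
  proof
    fix f g h assume f: "f \<in> carrier A" and g: "g \<in> carrier A" and h: "h \<in> carrier A"
    have *: "f [] = 0" "g [] = 0" using f g nonempty by auto
    show "f \<otimes>\<^bsub>A\<^esub> g \<otimes>\<^bsub>A\<^esub> h = f \<otimes>\<^bsub>A\<^esub> (g \<otimes>\<^bsub>A\<^esub> h)" using word_conv_assoc[of f g h] * by simp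
    show "(f \<oplus>\<^bsub>A\<^esub> g) \<otimes>\<^bsub>A\<^esub> h = f \<otimes>\<^bsub>A\<^esub> h \<oplus>\<^bsub>A\<^esub> g \<otimes>\<^bsub>A\<^esub> h" "h \<otimes>\<^bsub>A\<^esub> (f \<oplus>\<^bsub>A\<^esub> g) = h \<otimes>\<^bsub>A\<^esub> f \<oplus>\<^bsub>A\<^esub> h \<otimes>\<^bsub>A\<^esub> g"
      by (auto simp: word_conv_def fun_eq_iff distrib_left distrib_right sum.distrib)
  next
    fix f g assume f: "f \<in> carrier A" and g: "g \<in> carrier A"
    note c = word_conv_weighted_le[of "\<lambda>_. 1" f g W]
    show "f \<otimes>\<^bsub>A\<^esub> g \<in> carrier A" using c(1) f g by (simp add: word_conv_def)
    show "alg_norm A (f \<otimes>\<^bsub>A\<^esub> g) \<le> alg_norm A f * alg_norm A g" using c(2) f g by simp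
    show "alg_norm A (f \<oplus>\<^bsub>A\<^esub> g) \<le> alg_norm A f + alg_norm A g" using norm_triangle_l1(2)[of f g] f g by simp
    show "(c \<odot>\<^bsub>A\<^esub> f) \<otimes>\<^bsub>A\<^esub> g = c \<odot>\<^bsub>A\<^esub> (f \<otimes>\<^bsub>A\<^esub> g)" "f \<otimes>\<^bsub>A\<^esub> (c \<odot>\<^bsub>A\<^esub> g) = c \<odot>\<^bsub>A\<^esub> (f \<otimes>\<^bsub>A\<^esub> g)" for c
      by (auto simp: word_conv_def fun_eq_iff sum_distrib_left mult_ac)
    show "0 \<le> alg_norm A f" by (simp add: infsum_nonneg)
    show "(alg_norm A f = 0) = (f = \<zero>\<^bsub>A\<^esub>)" using l1_zeroD[of f] f by auto
    show "alg_norm A (c \<odot>\<^bsub>A\<^esub> f) = cmod c * alg_norm A f" for c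
      by (simp add: norm_mult infsum_cmult_right')
  qed
qed (auto simp: norm_triangle_l1(1) norm_mult fun_eq_iff algebra_simps intro!: summable_on_cmult_right)

sublocale complex_normed_algebra A by (rule word_algebra)

lemma word_alg_Banach: "A \<in> BA"
proof -
  have "\<exists>g\<in>carrier A. \<forall>\<epsilon>>0. \<exists>N. \<forall>n\<ge>N. alg_norm A (f n \<oplus>\<^bsub>A\<^esub> (-1) \<odot>\<^bsub>A\<^esub> g) < \<epsilon>"
    if f: "range f \<subseteq> carrier A"
      and cau: "\<forall>\<epsilon>>0. \<exists>N. \<forall>m\<ge>N. \<forall>n\<ge>N. alg_norm A (f m \<oplus>\<^bsub>A\<^esub> (-1) \<odot>\<^bsub>A\<^esub> f n) < \<epsilon>" for f :: "nat \<Rightarrow> _"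
  proof -
    have fs: "(\<lambda>w. cmod (f n w)) summable_on UNIV" for n using f by auto
    have ds: "(\<lambda>w. cmod (f m w - f n w)) summable_on UNIV" for m n
      using norm_triangle_l1(1)[of "f m" "\<lambda>w. - f n w"] fs by simp
    have cau': "\<exists>N. \<forall>m\<ge>N. \<forall>n\<ge>N. (\<Sum>\<^sub>\<infinity>w. cmod (f m w - f n w)) < \<epsilon>" if "\<epsilon> > 0" for \<epsilon>
      using cau that by simp
    have "Cauchy (\<lambda>n. f n w)" for w
    proof (rule metric_CauchyI)
      fix e :: real assume "e > 0"
      then obtain N where N: "\<forall>m\<ge>N. \<forall>n\<ge>N. (\<Sum>\<^sub>\<infinity>w. cmod (f m w - f n w)) < e" using cau' by blast
      have "dist (f m w) (f n w) < e" if "m \<ge> N" "n \<ge> N" for m n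
        using finite_sum_le_infsum[OF ds[of m n], of "{w}"] N that by (fastforce simp: dist_norm)
      then show "\<exists>N. \<forall>m\<ge>N. \<forall>n\<ge>N. dist (f m w) (f n w) < e" by blast
    qed
    then have "\<forall>w. \<exists>l. (\<lambda>n. f n w) \<longlonglongrightarrow> l" using Cauchy_convergent_iff convergent_def by blast
    then obtain g where g: "\<And>w. (\<lambda>n. f n w) \<longlonglongrightarrow> g w" by metis
    have close: "(\<lambda>w. cmod (f n w - g w)) summable_on UNIV \<and> (\<Sum>\<^sub>\<infinity>w. cmod (f n w - g w)) \<le> \<epsilon>"
      if N: "\<forall>m\<ge>N. \<forall>n\<ge>N. (\<Sum>\<^sub>\<infinity>w. cmod (f m w - f n w)) < \<epsilon>" "n \<ge> N" for n N \<epsilon>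
    proof -
      have fin: "(\<Sum>w\<in>F. cmod (f n w - g w)) \<le> \<epsilon>" if F: "finite F" for F
      proof (rule LIMSEQ_le_const2)
        show "(\<lambda>m. \<Sum>w\<in>F. cmod (f n w - f m w)) \<longlonglongrightarrow> (\<Sum>w\<in>F. cmod (f n w - g w))"
          by (intro tendsto_intros g)
        have "(\<Sum>w\<in>F. cmod (f n w - f m w)) \<le> \<epsilon>" if "m \<ge> N" for m
        proof -
          have "(\<Sum>w\<in>F. cmod (f n w - f m w)) \<le> (\<Sum>\<^sub>\<infinity>w. cmod (f n w - f m w))"
            using F by (intro finite_sum_le_infsum ds) auto
          also have "\<dots> < \<epsilon>" using N that by blast
          finally show ?thesis by simp
        qed
        then show "\<exists>N. \<forall>m\<ge>N. (\<Sum>w\<in>F. cmod (f n w - f m w)) \<le> \<epsilon>" by blast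
      qed
      show ?thesis using nonneg_summable_boundedI[OF _ fin] by simp
    qed
    obtain N where "\<forall>m\<ge>N. \<forall>n\<ge>N. (\<Sum>\<^sub>\<infinity>w. cmod (f m w - f n w)) < 1" using cau'[of 1] by auto
    then have "(\<lambda>w. cmod (f N w - g w)) summable_on UNIV" using close by blast
    then have gs: "(\<lambda>w. cmod (g w)) summable_on UNIV"
      using norm_triangle_l1(1)[of "f N" "\<lambda>w. - (f N w - g w)"] fs by (simp add: norm_minus_commute)
    have "g w = 0" if "w \<notin> W" for w
    proof -
      have "(\<lambda>n. f n w) = (\<lambda>_. 0)" using f that by auto
      then show ?thesis using g[of w] LIMSEQ_unique tendsto_const by metis
    qed
    then have "g \<in> carrier A" using gs by simp
    moreover have "\<forall>\<epsilon>>0. \<exists>N. \<forall>n\<ge>N. alg_norm A (f n \<oplus>\<^bsub>A\<^esub> (-1) \<odot>\<^bsub>A\<^esub> g) < \<epsilon>"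
    proof (intro allI impI)
      fix \<epsilon> :: real assume "\<epsilon> > 0"
      then obtain N where N: "\<forall>m\<ge>N. \<forall>n\<ge>N. (\<Sum>\<^sub>\<infinity>w. cmod (f m w - f n w)) < \<epsilon> / 2"
        using cau'[of "\<epsilon> / 2"] by auto
      have "alg_norm A (f n \<oplus>\<^bsub>A\<^esub> (-1) \<odot>\<^bsub>A\<^esub> g) < \<epsilon>" if "n \<ge> N" for n
        using close[OF N that] \<open>\<epsilon> > 0\<close> by simp
      then show "\<exists>N. \<forall>n\<ge>N. alg_norm A (f n \<oplus>\<^bsub>A\<^esub> (-1) \<odot>\<^bsub>A\<^esub> g) < \<epsilon>" by blast
    qed
    ultimately show ?thesis by blast
  qed
  then have "mcomplete" unfolding mcomplete_iff by blast
  then show ?thesis using word_algebra by (simp add: BA_def NA_def)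
qed

definition basis :: "complex \<Rightarrow> 'l list \<Rightarrow> 'l list \<Rightarrow> complex"
  where "basis c w = (\<lambda>v. if v = w then c else 0)"

lemma norm_basis: "(\<lambda>v. cmod (basis c w v)) summable_on UNIV" "(\<Sum>\<^sub>\<infinity>v. cmod (basis c w v)) = cmod c"
proof -
  have "((\<lambda>v. cmod (basis c w v)) has_sum (\<Sum>v\<in>{w}. cmod (basis c w v))) UNIV"
    by (rule has_sum_finite_neutralI[where B = "{w}"]) (auto simp: basis_def)
  then show "(\<lambda>v. cmod (basis c w v)) summable_on UNIV" "(\<Sum>\<^sub>\<infinity>v. cmod (basis c w v)) = cmod c"
    by (auto simp: basis_def has_sum_imp_summable infsumI)
qed

lemma basis_closed: "w \<in> W \<Longrightarrow> basis c w \<in> carrier A"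
  using norm_basis(1)[of c w] by (auto simp: basis_def)

lemma conv_basis:
  "word_conv W (basis c u) (basis d v) = (if u @ v \<in> W then basis (c * d) (u @ v) else (\<lambda>_. 0))"
proof
  fix w
  have "(\<Sum>k\<le>length w. basis c u (take k w) * basis d v (drop k w)) = basis (c * d) (u @ v) w"
  proof -
    have "basis c u (take k w) * basis d v (drop k w) = (if k = length u then basis (c * d) (u @ v) w else 0)"
      if "k \<le> length w" for k
    proof (cases "take k w = u \<and> drop k w = v")
      case True
      then have "length (take k w) = length u" "w = u @ v" using append_take_drop_id[of k w] by auto
      then have "w = u @ v" "k = length u" using that by auto
      then show ?thesis by (simp add: basis_def)
    next
      case False
      moreover have "\<not> (k = length u \<and> w = u @ v)" using False by auto
      ultimately show ?thesis by (auto simp: basis_def)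
    qed
    then have "(\<Sum>k\<le>length w. basis c u (take k w) * basis d v (drop k w))
        = (\<Sum>k\<le>length w. if k = length u then basis (c * d) (u @ v) w else 0)" by simp
    also have "\<dots> = basis (c * d) (u @ v) w" by (auto simp: basis_def)
    finally show ?thesis .
  qed
  then show "word_conv W (basis c u) (basis d v) w = (if u @ v \<in> W then basis (c * d) (u @ v) else (\<lambda>_. 0)) w"
    by (auto simp: word_conv_def) (auto simp: basis_def)
qed

text \<open>
  The source of all lower bounds: a word of \<open>W\<close> is the product of its letters, so that scaled letters
  multiply to a nonzero multiple of it.
\<close>

lemma basis_in_set_power:
  assumes "w \<in> W" "\<And>l. l \<in> set w \<Longrightarrow> basis (c l) [l] \<in> M"
  shows "basis (\<Prod>l\<leftarrow>w. c l) w \<in> set_power A M (length w)"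
  using assms
proof (induction w rule: rev_induct)
  case Nil
  then show ?case using nonempty by simp
next
  case (snoc l w)
  show ?case
  proof (cases "w = []")
    case True
    then show ?thesis using snoc.prems by simp
  next
    case False
    then have "w \<in> W" using factor[of "[]" w "[l]"] snoc.prems by simp
    then have "basis (\<Prod>l\<leftarrow>w. c l) w \<otimes>\<^bsub>A\<^esub> basis (c l) [l] \<in> set_power A M (Suc (length w))"
      using snoc False by (intro set_power_SucI) (auto simp: Suc_le_eq)
    then show ?thesis using snoc.prems by (simp add: conv_basis)
  qed
qed

text \<open>
  The weighted norm is submultiplicative and at least \<open>c\<close> times the original norm on elements
  supported in \<open>T\<close>, so \<open>\<parallel>a\<parallel> \<le> s\<^sup>n / c\<close> for \<open>a \<in> M\<^sup>n\<close>. The set \<open>T\<close> makes it possible to treat words over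
  a smaller alphabet, where bounds on \<open>\<omega>\<close> may hold that fail on all of \<open>W\<close>.
\<close>

lemma jsr_le_weighted:
  assumes M: "M \<in> M_b A"
    and \<omega>: "\<And>w. 0 \<le> \<omega> w" "\<And>u v. \<omega> (u @ v) \<le> \<omega> u * \<omega> v"
    and T: "\<And>u v. \<lbrakk>u \<in> T; v \<in> T\<rbrakk> \<Longrightarrow> u @ v \<in> T"
    and C: "0 < c" "\<And>w. w \<in> W \<inter> T \<Longrightarrow> c \<le> \<omega> w" "\<And>w. w \<in> W \<inter> T \<Longrightarrow> \<omega> w \<le> C"
    and supp: "\<And>a w. \<lbrakk>a \<in> M; a w \<noteq> 0\<rbrakk> \<Longrightarrow> w \<in> T"
    and s: "\<And>a. a \<in> M \<Longrightarrow> (\<Sum>\<^sub>\<infinity>w. \<omega> w * cmod (a w)) \<le> s"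
  shows "joint_spectral_radius A M \<le> s"
proof -
  have Mc: "M \<subseteq> carrier A" "M \<noteq> {}" using M by (auto simp: M_b_def)
  have summ: "(\<lambda>w. \<omega> w * cmod (a w)) summable_on UNIV"
    if a: "a \<in> carrier A" "\<And>w. a w \<noteq> 0 \<Longrightarrow> w \<in> T" for a
  proof (rule summable_on_comparison_test)
    show "(\<lambda>w. C * cmod (a w)) summable_on UNIV" using a by (intro summable_on_cmult_right) simp
    show "\<omega> w * cmod (a w) \<le> C * cmod (a w)" for w
      using a C(3)[of w] by (cases "a w = 0") (auto intro!: mult_right_mono)
  qed (use \<omega> in auto)
  have pow: "(\<forall>w. a w \<noteq> 0 \<longrightarrow> w \<in> T) \<and> (\<Sum>\<^sub>\<infinity>w. \<omega> w * cmod (a w)) \<le> s ^ n"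
    if "n \<ge> 1" "a \<in> set_power A M n" for n a
    using that
  proof (induction n arbitrary: a rule: dec_induct)
    case base
    then show ?case using supp s by simp
  next
    case (step n)
    obtain u v where u: "u \<in> set_power A M n" "v \<in> M" "a = u \<otimes>\<^bsub>A\<^esub> v"
      by (rule set_power_SucE[OF step.prems step.hyps(1)])
    have uc: "u \<in> carrier A" "v \<in> carrier A" using u Mc set_power_closed[OF Mc(1)] by blast+
    have uT: "\<And>w. u w \<noteq> 0 \<Longrightarrow> w \<in> T" and us: "(\<Sum>\<^sub>\<infinity>w. \<omega> w * cmod (u w)) \<le> s ^ n"
      using step.IH[OF u(1)] by auto
    have vT: "\<And>w. v w \<noteq> 0 \<Longrightarrow> w \<in> T" using supp u(2) by blast
    have "w \<in> T" if "a w \<noteq> 0" for w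
    proof (rule ccontr)
      assume "w \<notin> T"
      then have "u (take k w) * v (drop k w) = 0" for k
        using T[of "take k w" "drop k w"] uT[of "take k w"] vT[of "drop k w"] by auto
      then have "(\<Sum>k\<le>length w. u (take k w) * v (drop k w)) = 0" by (intro sum.neutral) blast
      then show False using that u(3) by (simp add: word_conv_def split: if_splits)
    qed
    moreover have "(\<Sum>\<^sub>\<infinity>w. \<omega> w * cmod (a w)) \<le> (\<Sum>\<^sub>\<infinity>w. \<omega> w * cmod (u w)) * (\<Sum>\<^sub>\<infinity>w. \<omega> w * cmod (v w))"
      using word_conv_weighted_le(2)[OF \<omega> summ[OF uc(1) uT] summ[OF uc(2) vT]] u(3) by simp
    moreover have "\<dots> \<le> s ^ n * s"
      using us s[OF u(2)] \<omega>(1) zero_le_power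
      by (intro mult_mono) (auto intro!: infsum_nonneg order_trans[OF _ us])
    ultimately show ?case by (simp add: mult.commute)
  qed
  obtain a where "a \<in> M" using Mc by blast
  have "0 \<le> (\<Sum>\<^sub>\<infinity>w. \<omega> w * cmod (a w))" using \<omega> by (intro infsum_nonneg) auto
  then have s0: "0 \<le> s" using s[OF \<open>a \<in> M\<close>] by linarith
  show ?thesis
  proof (rule jsr_leI[OF M s0, where C = "1 / c"])
    fix n a assume n: "1 \<le> n" "a \<in> set_power A M n"
    have ac: "a \<in> carrier A" using n set_power_closed[OF Mc(1)] by blast
    have aT: "\<And>w. a w \<noteq> 0 \<Longrightarrow> w \<in> T" using pow[OF n] by blast
    have as: "(\<lambda>w. cmod (a w)) summable_on UNIV" using ac by simp
    have "c * (\<Sum>\<^sub>\<infinity>w. cmod (a w)) = (\<Sum>\<^sub>\<infinity>w. c * cmod (a w))" by (simp add: infsum_cmult_right')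
    also have "\<dots> \<le> (\<Sum>\<^sub>\<infinity>w. \<omega> w * cmod (a w))"
    proof (rule infsum_mono[OF summable_on_cmult_right[OF as] summ[OF ac aT]])
      show "c * cmod (a w) \<le> \<omega> w * cmod (a w)" for w
        using ac aT C(2)[of w] by (cases "a w = 0") (auto intro!: mult_right_mono)
    qed
    also have "\<dots> \<le> s ^ n" using pow[OF n] by blast
    finally show "alg_norm A a \<le> 1 / c * s ^ n" using C(1) by (simp add: field_simps)
  qed
qed

text \<open>
  A finite \<open>\<epsilon>/2\<close>-net reduces this to the single elements of the net.
\<close>

lemma totally_bounded_uniform_tails:
  assumes K: "K \<in> M_c A" and e: "0 < \<epsilon>"
  obtains S where "finite S" "\<And>a. a \<in> K \<Longrightarrow> (\<Sum>\<^sub>\<infinity>w. if w \<in> S then 0 else cmod (a w)) < \<epsilon>"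
proof -
  have tail_summable: "(\<lambda>w. if w \<in> S then 0 else cmod (a w)) summable_on UNIV" if "a \<in> carrier A" for a S
    by (rule summable_on_comparison_test[of "\<lambda>w. cmod (a w)"]) (use that in auto)
  have "\<exists>S. finite S \<and> (\<Sum>\<^sub>\<infinity>w. if w \<in> S then 0 else cmod (b w)) < \<epsilon> / 2" if b: "b \<in> carrier A" for b
  proof -
    have bs: "(\<lambda>w. cmod (b w)) summable_on UNIV" using b by simp
    obtain S where S: "finite S" "(\<Sum>\<^sub>\<infinity>w. cmod (b w)) - \<epsilon> / 2 < (\<Sum>w\<in>S. cmod (b w))"
      using infsum_le_finite_sums[OF bs, of "(\<Sum>\<^sub>\<infinity>w. cmod (b w)) - \<epsilon> / 2"] e by force
    have "((\<lambda>w. if w \<in> S then cmod (b w) else 0) has_sum (\<Sum>w\<in>S. cmod (b w))) UNIV"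
      by (rule has_sum_finite_neutralI) (use S in auto)
    then have h: "(\<lambda>w. if w \<in> S then cmod (b w) else 0) summable_on UNIV"
      "(\<Sum>\<^sub>\<infinity>w. if w \<in> S then cmod (b w) else 0) = (\<Sum>w\<in>S. cmod (b w))"
      by (auto simp: has_sum_imp_summable infsumI)
    have "(\<Sum>\<^sub>\<infinity>w. cmod (b w))
        = (\<Sum>\<^sub>\<infinity>w. (if w \<in> S then cmod (b w) else 0) + (if w \<in> S then 0 else cmod (b w)))"
      by (intro infsum_cong) auto
    also have "\<dots> = (\<Sum>w\<in>S. cmod (b w)) + (\<Sum>\<^sub>\<infinity>w. if w \<in> S then 0 else cmod (b w))"
      using infsum_add[OF h(1) tail_summable[OF b]] h(2) by simp
    finally show ?thesis using S by (intro exI[of _ S]) auto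
  qed
  then have "\<exists>S. \<forall>b\<in>carrier A. finite (S b) \<and> (\<Sum>\<^sub>\<infinity>w. if w \<in> S b then 0 else cmod (b w)) < \<epsilon> / 2"
    by (intro bchoice) simp
  then obtain S where
    "\<forall>b\<in>carrier A. finite (S b) \<and> (\<Sum>\<^sub>\<infinity>w. if w \<in> S b then 0 else cmod (b w)) < \<epsilon> / 2" ..
  then have S: "\<And>b. b \<in> carrier A \<Longrightarrow> finite (S b)"
    "\<And>b. b \<in> carrier A \<Longrightarrow> (\<Sum>\<^sub>\<infinity>w. if w \<in> S b then 0 else cmod (b w)) < \<epsilon> / 2" by simp_all
  obtain N where N: "finite N" "N \<subseteq> K" "\<forall>a\<in>K. \<exists>b\<in>N. alg_norm A (b \<oplus>\<^bsub>A\<^esub> (-1) \<odot>\<^bsub>A\<^esub> a) < \<epsilon> / 2"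
    using conjunct2[OF conjunct2[OF K[unfolded M_c_iff]], rule_format, of "\<epsilon> / 2"] e by auto
  have Kc: "K \<subseteq> carrier A" using K by (simp add: M_c_def)
  show ?thesis
  proof
    show "finite (\<Union>b\<in>N. S b)" using N S Kc by blast
    fix a assume a: "a \<in> K"
    then obtain b where b: "b \<in> N" "alg_norm A (b \<oplus>\<^bsub>A\<^esub> (-1) \<odot>\<^bsub>A\<^esub> a) < \<epsilon> / 2" using N by blast
    have ac: "a \<in> carrier A" and bc: "b \<in> carrier A" using a b N Kc by blast+
    have d: "(\<lambda>w. cmod (b w - a w)) summable_on UNIV"
      using norm_triangle_l1(1)[of b "\<lambda>w. - a w"] ac bc by simp
    have "(\<Sum>\<^sub>\<infinity>w. if w \<in> (\<Union>b\<in>N. S b) then 0 else cmod (a w))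
        \<le> (\<Sum>\<^sub>\<infinity>w. cmod (b w - a w) + (if w \<in> S b then 0 else cmod (b w)))"
    proof (rule infsum_mono[OF tail_summable[OF ac] summable_on_add[OF d tail_summable[OF bc]]])
      show "(if w \<in> (\<Union>b\<in>N. S b) then 0 else cmod (a w))
          \<le> cmod (b w - a w) + (if w \<in> S b then 0 else cmod (b w))" for w
        using b(1) norm_triangle_sub[of "a w" "b w"] by (auto simp: norm_minus_commute)
    qed
    also have "\<dots> = (\<Sum>\<^sub>\<infinity>w. cmod (b w - a w)) + (\<Sum>\<^sub>\<infinity>w. if w \<in> S b then 0 else cmod (b w))"
      by (rule infsum_add[OF d tail_summable[OF bc]])
    also have "\<dots> < \<epsilon> / 2 + \<epsilon> / 2" using b(2) S(2)[OF bc] by (intro add_strict_mono) simp_all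
    finally show "(\<Sum>\<^sub>\<infinity>w. if w \<in> (\<Union>b\<in>N. S b) then 0 else cmod (a w)) < \<epsilon>" by simp
  qed
qed

lemma letters_norm_bounded:
  assumes "M \<noteq> {}" "\<And>a. a \<in> M \<Longrightarrow> \<exists>w\<in>W. a = basis 1 w" shows "M \<in> M_b A"
proof -
  have "a \<in> carrier A \<and> alg_norm A a \<le> 1" if "a \<in> M" for a
    using assms(2)[OF that] basis_closed norm_basis(2)[of 1] by auto
  then show ?thesis using assms(1) unfolding M_b_iff by blast
qed

text \<open>
  A word of \<open>W\<close> cannot contain \<open>w\<close> twice without overlap, so the ideal generated by \<open>w\<close> has square
  zero.
\<close>

lemma basis_in_R_b:
  assumes w: "w \<in> W" and rep: "\<And>u. w @ u @ w \<notin> W"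
  shows "basis c w \<in> R_b A"
proof (rule square_zero_ideal_subset_R_b)
  show "basis c w \<in> carrier A" using w by (rule basis_closed)
  show "basis c w \<otimes>\<^bsub>A\<^esub> basis c w = \<zero>\<^bsub>A\<^esub>" using rep[of "[]"] by (simp add: conv_basis)
  fix b
  have "word_conv W (word_conv W (basis c w) b) (basis c w) v = 0" for v
  proof (rule ccontr)
    assume nz: "word_conv W (word_conv W (basis c w) b) (basis c w) v \<noteq> 0"
    then have v: "v \<in> W" by (auto simp: word_conv_def split: if_splits)
    then have "(\<Sum>k\<le>length v. word_conv W (basis c w) b (take k v) * basis c w (drop k v)) \<noteq> 0"
      using nz by (simp add: word_conv_def)
    then obtain k where k: "word_conv W (basis c w) b (take k v) * basis c w (drop k v) \<noteq> 0"
      using sum.not_neutral_contains_not_neutral by blast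
    then have d: "drop k v = w" by (auto simp: basis_def split: if_splits)
    have "(\<Sum>j\<le>length (take k v). basis c w (take j (take k v)) * b (drop j (take k v))) \<noteq> 0"
      using k by (auto simp: word_conv_def split: if_splits)
    then obtain j where "basis c w (take j (take k v)) * b (drop j (take k v)) \<noteq> 0"
      using sum.not_neutral_contains_not_neutral by blast
    then have t: "take j (take k v) = w" by (auto simp: basis_def split: if_splits)
    have "v = w @ drop j (take k v) @ w"
      using append_take_drop_id[of j "take k v"] append_take_drop_id[of k v] t d by (metis append.assoc)
    then show False using v rep by metis
  qed
  then show "basis c w \<otimes>\<^bsub>A\<^esub> b \<otimes>\<^bsub>A\<^esub> basis c w = \<zero>\<^bsub>A\<^esub>" by auto
qed

text \<open>
  An element is the limit of its finite truncations.
\<close>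

lemma closed_ideal_contains_span:
  assumes I: "closed_alg_ideal A I" and f: "f \<in> carrier A"
    and basis: "\<And>w. f w \<noteq> 0 \<Longrightarrow> basis (f w) w \<in> I"
  shows "f \<in> I"
proof -
  have id: "alg_ideal A I" and cl: "closedin mtopology I" using I by (auto simp: closed_alg_ideal_def)
  have trunc: "(\<lambda>w. if w \<in> S then f w else 0) \<in> I" if "finite S" for S
    using that
  proof (induction S)
    case empty
    then show ?case using alg_idealD(2)[OF id] by simp
  next
    case (insert v S)
    have "basis (f v) v \<in> I"
    proof (cases "f v = 0")
      case True
      then have "basis (f v) v = \<zero>\<^bsub>A\<^esub>" by (auto simp: basis_def)
      then show ?thesis using alg_idealD(2)[OF id] by simp
    qed (rule basis)
    then have "(\<lambda>w. if w \<in> S then f w else 0) \<oplus>\<^bsub>A\<^esub> basis (f v) v \<in> I"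
      using alg_idealD(3)[OF id insert.IH] by blast
    moreover have "(\<lambda>w. if w \<in> S then f w else 0) \<oplus>\<^bsub>A\<^esub> basis (f v) v = (\<lambda>w. if w \<in> insert v S then f w else 0)"
      using insert.hyps by (auto simp: basis_def)
    ultimately show ?case by simp
  qed
  have "\<exists>y\<in>I. alg_norm A (f \<oplus>\<^bsub>A\<^esub> (-1) \<odot>\<^bsub>A\<^esub> y) < \<epsilon>" if e: "0 < \<epsilon>" for \<epsilon>
  proof -
    have "{f} \<in> M_c A" using M_f_subset_M_c f by (auto simp: M_f_def)
    then obtain S where S: "finite S" "\<And>a. a \<in> {f} \<Longrightarrow> (\<Sum>\<^sub>\<infinity>w. if w \<in> S then 0 else cmod (a w)) < \<epsilon>"
      using totally_bounded_uniform_tails[OF _ e] by metis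
    have "alg_norm A (f \<oplus>\<^bsub>A\<^esub> (-1) \<odot>\<^bsub>A\<^esub> (\<lambda>w. if w \<in> S then f w else 0))
        = (\<Sum>\<^sub>\<infinity>w. if w \<in> S then 0 else cmod (f w))"
      by (auto intro!: infsum_cong)
    then show ?thesis using S trunc[OF S(1)] by (intro bexI) auto
  qed
  then show ?thesis using cl f unfolding closedin_iff by blast
qed

end

section \<open>Alternating words\<close>

definition alternating_words :: "nat list set" where
  "alternating_words = {w. w \<noteq> [] \<and> successively (\<lambda>a b. (a = 0) \<noteq> (b = 0)) w \<and>
     distinct (filter (\<lambda>l. l \<noteq> 0) w)}"

interpretation alt: word_system alternating_words
  by standard (auto simp: alternating_words_def successively_append_iff)

text \<open>
  Zeros and nonzero letters alternate, so their numbers differ by at most one. The first letter is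
  tracked for the induction.
\<close>

lemma alternating_balance:
  assumes "successively (\<lambda>a b. (a = 0) \<noteq> (b = 0)) w" "w \<noteq> ([] :: nat list)"
  shows "(\<Sum>l\<leftarrow>w. if l = 0 then 1 else - 1 :: int) \<in> (if hd w = 0 then {0, 1} else {-1, 0})"
  using assms
proof (induction w)
  case (Cons a w)
  then show ?case by (cases "w = []") (auto simp: successively_Cons split: if_splits)
qed simp

text \<open>
  The weight of a word will be \<open>t\<close> to this power: letters up to \<open>m\<close> contribute a factor \<open>t\<close> and the
  others a factor \<open>1/t\<close>.
\<close>

definition damping :: "nat \<Rightarrow> nat list \<Rightarrow> int" where
  "damping m w = (\<Sum>l\<leftarrow>w. if l \<le> m then 1 else - 1)"

lemma damping_append: "damping m (u @ v) = damping m u + damping m v"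
  by (simp add: damping_def)

lemma damping_small: "(\<And>l. l \<in> set w \<Longrightarrow> l \<le> m) \<Longrightarrow> damping m w = int (length w)"
  by (induction w) (auto simp: damping_def)

text \<open>
  Compare with the balance of zeros against nonzero letters, which lies in \<open>{-1, 0, 1}\<close>: the two
  sums differ by \<open>2\<close> for each letter in \<open>{1..m}\<close>, and there are at most \<open>m\<close> of these.
\<close>

lemma damping_bounds:
  assumes "w \<in> alternating_words"
  shows "-1 \<le> damping m w" "damping m w \<le> 2 * int m + 1"
proof -
  let ?s = "filter (\<lambda>l. l \<noteq> 0 \<and> l \<le> m) w"
  have bal: "-1 \<le> (\<Sum>l\<leftarrow>w. if l = 0 then 1 else - 1 :: int)"
    "(\<Sum>l\<leftarrow>w. if l = 0 then 1 else - 1 :: int) \<le> 1"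
    using alternating_balance[of w] assms by (auto simp: alternating_words_def split: if_splits)
  have "damping m w = (\<Sum>l\<leftarrow>w. if l = 0 then 1 else - 1 :: int) + 2 * int (length ?s)"
    unfolding damping_def by (induction w) auto
  moreover have "length ?s \<le> m"
  proof -
    have "distinct (filter (\<lambda>l. l \<le> m) (filter (\<lambda>l. l \<noteq> 0) w))"
      using assms by (intro distinct_filter[of "filter (\<lambda>l. l \<noteq> 0) w"]) (simp add: alternating_words_def)
    then have "distinct ?s" by (simp only: filter_filter)
    then have "length ?s = card (set ?s)" by (rule distinct_card[symmetric])
    also have "\<dots> \<le> card {1..m}" by (intro card_mono) auto
    finally show ?thesis by simp
  qed
  ultimately show "-1 \<le> damping m w" "damping m w \<le> 2 * int m + 1" using bal by linarith+
qed

text \<open>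
  Fix \<open>t < 1\<close>. Up to an error \<open>t\<^sup>2\<close> the elements of \<open>K\<close> are supported on a finite set of words, which
  involve letters up to some \<open>m\<close> only. On these words the weight is at most \<open>t\<close>, on the others at most
  \<open>1/t\<close>, so the weighted norm on \<open>K\<close> is at most \<open>t B + t\<^sup>2 / t\<close> with a bound \<open>B\<close> of \<open>K\<close>; and \<open>t\<close> is
  arbitrary.
\<close>

lemma alternating_precompact_jsr:
  assumes K: "K \<in> M_c alt.A" shows "joint_spectral_radius alt.A K = 0"
proof (rule antisym)
  have Kb: "K \<in> M_b alt.A" using K alt.M_c_subset_M_b by blast
  then obtain B where Kc: "K \<subseteq> carrier alt.A" and B: "\<And>a. a \<in> K \<Longrightarrow> alg_norm alt.A a \<le> B"
    unfolding alt.M_b_iff by blast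
  have "joint_spectral_radius alt.A K \<le> t * (B + 1)" if t: "0 < t" "t < 1" for t
  proof -
    obtain S where S: "finite S"
      "\<And>a. a \<in> K \<Longrightarrow> (\<Sum>\<^sub>\<infinity>w. if w \<in> S then 0 else cmod (a w)) < t\<^sup>2"
      by (rule alt.totally_bounded_uniform_tails[OF K, of "t\<^sup>2"]) (use t in auto)
    define m where "m = Max (insert 0 (\<Union>w\<in>S. set w))"
    have m: "l \<le> m" if "w \<in> S" "l \<in> set w" for l w
      unfolding m_def using that S(1) by (intro Max_ge) auto
    define \<omega> where "\<omega> w = t powi damping m w" for w
    have low: "\<omega> w \<le> t" if "w \<in> alternating_words" "w \<in> S" for w
    proof -
      have "1 \<le> damping m w"
        using that damping_small[of w m] m by (cases w) (auto simp: alternating_words_def)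
      then show ?thesis
        using power_int_decreasing[of 1 "damping m w" t] t by (simp add: \<omega>_def)
    qed
    have high: "\<omega> w \<le> 1 / t" if "w \<in> alternating_words" for w
      using power_int_decreasing[OF damping_bounds(1)[OF that], of t m] t
      by (simp add: \<omega>_def power_int_minus inverse_eq_divide)
    show ?thesis
    proof (rule alt.jsr_le_weighted[OF Kb, where \<omega> = \<omega> and T = UNIV and C = "1 / t" and c = "t powi (2 * int m + 1)"])
      show "0 \<le> \<omega> w" for w using t by (simp add: \<omega>_def)
      show "\<omega> (u @ v) \<le> \<omega> u * \<omega> v" for u v
        using t by (simp add: \<omega>_def damping_append power_int_add)
      show "0 < t powi (2 * int m + 1)" using t by simp
      show "t powi (2 * int m + 1) \<le> \<omega> w" if "w \<in> alternating_words \<inter> UNIV" for w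
        using power_int_decreasing[of "damping m w" "2 * int m + 1" t] damping_bounds(2)[of w m] that t
        by (simp add: \<omega>_def)
      show "\<omega> w \<le> 1 / t" if "w \<in> alternating_words \<inter> UNIV" for w using high that by simp
      fix a assume a: "a \<in> K"
      have as: "(\<lambda>w. cmod (a w)) summable_on UNIV" and supp: "\<And>w. w \<notin> alternating_words \<Longrightarrow> a w = 0"
        using a Kc by auto
      have ts: "(\<lambda>w. if w \<in> S then 0 else cmod (a w)) summable_on UNIV"
        by (rule summable_on_comparison_test[OF as]) auto
      have rs: "(\<lambda>w. t * cmod (a w) + (1 / t) * (if w \<in> S then 0 else cmod (a w))) summable_on UNIV"
        by (intro summable_on_add summable_on_cmult_right as ts)
      have pt: "\<omega> w * cmod (a w) \<le> t * cmod (a w) + (1 / t) * (if w \<in> S then 0 else cmod (a w))" for w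
      proof (cases "a w = 0")
        case False
        then have w: "w \<in> alternating_words" using supp by blast
        show ?thesis
        proof (cases "w \<in> S")
          case True
          then show ?thesis using low[OF w] by (simp add: mult_right_mono)
        next
          case False
          have "\<omega> w * cmod (a w) \<le> (1 / t) * cmod (a w)" using high[OF w] by (intro mult_right_mono) auto
          moreover have "0 \<le> t * cmod (a w)" using t by simp
          ultimately show ?thesis using False by simp
        qed
      qed simp
      have ws: "(\<lambda>w. \<omega> w * cmod (a w)) summable_on UNIV"
        by (rule summable_on_comparison_test[OF rs pt]) (use t in \<open>simp add: \<omega>_def\<close>)
      have "(\<Sum>\<^sub>\<infinity>w. \<omega> w * cmod (a w))
          \<le> (\<Sum>\<^sub>\<infinity>w. t * cmod (a w) + (1 / t) * (if w \<in> S then 0 else cmod (a w)))"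
        by (rule infsum_mono[OF ws rs pt])
      also have "\<dots> = t * (\<Sum>\<^sub>\<infinity>w. cmod (a w)) + (1 / t) * (\<Sum>\<^sub>\<infinity>w. if w \<in> S then 0 else cmod (a w))"
        by (simp only: infsum_add[OF summable_on_cmult_right[OF as] summable_on_cmult_right[OF ts]]
          infsum_cmult_right')
      also have "\<dots> \<le> t * B + (1 / t) * t\<^sup>2"
        using B[OF a] S(2)[OF a] t by (intro add_mono mult_left_mono) auto
      also have "\<dots> = t * (B + 1)" using t by (simp add: power2_eq_square distrib_left)
      finally show "(\<Sum>\<^sub>\<infinity>w. \<omega> w * cmod (a w)) \<le> t * (B + 1)" .
    qed auto
  qed
  then show "joint_spectral_radius alt.A K \<le> 0" by (rule nonpos_if_le_small_multiples)
  show "0 \<le> joint_spectral_radius alt.A K" by (rule alt.jsr_nonneg[OF Kb])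
qed

text \<open>
  The nonzero letters multiply to \<open>0\<close> among themselves, but with the letter \<open>0\<close> between them they form
  basis words of every length.
\<close>

lemma alternating_zero_notin_R_b: "alt.basis 1 [0] \<notin> R_b alt.A"
proof
  assume x: "alt.basis 1 [0] \<in> R_b alt.A"
  define M where "M = (\<lambda>l. alt.basis 1 [l]) ` {1::nat..}"
  have letter: "[l] \<in> alternating_words" for l :: nat by (simp add: alternating_words_def)
  have Mb: "M \<in> M_b alt.A" and Nb: "{alt.basis 1 [0]} \<union> M \<in> M_b alt.A"
    by (rule alt.letters_norm_bounded; use letter in \<open>auto simp: M_def\<close>)+
  have "joint_spectral_radius alt.A M = 0"
  proof (rule alt.jsr_square_zero[OF Mb])
    have "[i, j] \<notin> alternating_words" if "1 \<le> i" "1 \<le> j" for i j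
      using that by (simp add: alternating_words_def)
    moreover fix a b assume "a \<in> M" "b \<in> M"
    ultimately show "a \<otimes>\<^bsub>alt.A\<^esub> b = \<zero>\<^bsub>alt.A\<^esub>"
      by (auto simp: M_def alt.conv_basis)
  qed
  moreover have "1 \<le> joint_spectral_radius alt.A ({alt.basis 1 [0]} \<union> M)"
  proof (rule alt.jsr_geI[OF Nb])
    fix n :: nat assume n: "n \<ge> 1"
    \<comment> \<open>the word \<open>0 1 0 3 0 5 \<dots>\<close> of length \<open>n\<close>\<close>
    define w where "w = map (\<lambda>i. if even i then 0 else i) [0..<n]"
    have "w \<in> alternating_words"
      unfolding alternating_words_def
    proof (intro CollectI conjI)
      show "w \<noteq> []" using n by (simp add: w_def)
      show "successively (\<lambda>a b. (a = 0) \<noteq> (b = 0)) w"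
        by (auto simp: w_def successively_conv_nth elim: oddE)
      show "distinct (filter (\<lambda>l. l \<noteq> 0) w)"
        by (auto simp: w_def filter_map distinct_map inj_on_def o_def split: if_splits)
    qed
    then have "alt.basis (\<Prod>l\<leftarrow>w. 1) w \<in> set_power alt.A ({alt.basis 1 [0]} \<union> M) (length w)"
    proof (rule alt.basis_in_set_power)
      show "alt.basis 1 [l] \<in> {alt.basis 1 [0]} \<union> M" for l by (cases "l = 0") (auto simp: M_def)
    qed
    moreover have "(\<Prod>l\<leftarrow>v. 1 :: complex) = 1" for v :: "nat list" by (induction v) auto
    moreover have "length w = n" by (simp add: w_def)
    ultimately have "alt.basis 1 w \<in> set_power alt.A ({alt.basis 1 [0]} \<union> M) n" by metis
    then have "alg_norm alt.A (alt.basis 1 w) \<le> set_norm alt.A (set_power alt.A ({alt.basis 1 [0]} \<union> M) n)"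
      by (rule alt.norm_le_set_norm[OF alt.set_power_bounded[OF Nb n]])
    then show "1 ^ n \<le> set_norm alt.A (set_power alt.A ({alt.basis 1 [0]} \<union> M) n)"
      by (simp add: alt.norm_basis)
  qed simp
  moreover have "joint_spectral_radius alt.A ({alt.basis 1 [0]} \<union> M) = joint_spectral_radius alt.A M"
    using x Mb by (auto simp: R_b_def jsr_radical_def)
  ultimately show False by simp
qed

text \<open>
  A product has no components at single letters, and a longer alternating word contains a nonzero
  letter, which cannot be repeated.
\<close>

lemma alternating_products:
  assumes I: "closed_alg_ideal alt.A (R_b alt.A)" and f: "f \<in> carrier alt.A" and g: "g \<in> carrier alt.A"
  shows "f \<otimes>\<^bsub>alt.A\<^esub> g \<in> R_b alt.A"
proof (rule alt.closed_ideal_contains_span[OF I])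
  show "f \<otimes>\<^bsub>alt.A\<^esub> g \<in> carrier alt.A" using f g by (rule alt.mult_closed)
  fix w assume "(f \<otimes>\<^bsub>alt.A\<^esub> g) w \<noteq> 0"
  then have w: "w \<in> alternating_words" and nz: "(\<Sum>k\<le>length w. f (take k w) * g (drop k w)) \<noteq> 0"
    by (auto simp: word_conv_def split: if_splits)
  have "\<exists>l\<in>set w. l \<noteq> 0"
  proof (rule ccontr)
    assume no: "\<not> (\<exists>l\<in>set w. l \<noteq> 0)"
    obtain a v where v: "w = a # v" using w by (cases w) (auto simp: alternating_words_def)
    have "v = []"
      using w no v by (cases v) (auto simp: alternating_words_def)
    moreover have "f [] = 0" "g [] = 0" using f g alt.nonempty by auto
    ultimately show False using nz v by (simp add: atMost_Suc)
  qed
  then obtain l where l: "l \<in> set w" "l \<noteq> 0" by blast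
  have "w @ u @ w \<notin> alternating_words" for u using l by (auto simp: alternating_words_def)
  then show "alt.basis ((f \<otimes>\<^bsub>alt.A\<^esub> g) w) w \<in> R_b alt.A" by (rule alt.basis_in_R_b[OF w])
qed

section \<open>Ruler words\<close>

fun ruler :: "nat \<Rightarrow> nat list" where
  "ruler 0 = [0]"
| "ruler (Suc k) = ruler k @ [Suc k] @ ruler k"

definition ruler_words :: "nat list set" where
  "ruler_words = {v. v \<noteq> [] \<and> (\<exists>k u w. ruler k = u @ v @ w)}"

interpretation ruler: word_system ruler_words
proof
  fix u v w assume "u @ v @ w \<in> ruler_words" "v \<noteq> []"
  moreover then obtain k x y where "ruler k = x @ (u @ v @ w) @ y" by (auto simp: ruler_words_def)
  then have "ruler k = (x @ u) @ v @ (w @ y)" by simp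
  ultimately show "v \<in> ruler_words" unfolding ruler_words_def by blast
qed (simp add: ruler_words_def)

lemma length_ruler: "length (ruler k) + 1 = 2 ^ (k + 1)"
  by (induction k) auto

lemma sum_list_ruler: "sum_list (ruler k) + k + 2 = 2 ^ (k + 1)"
  by (induction k) auto

text \<open>
  A factor of \<open>ruler (Suc k)\<close> either contains the middle letter \<open>Suc k\<close>, so that \<open>Suc k < N\<close> and the
  whole word is short enough, or lies in one of the two copies of \<open>ruler k\<close>.
\<close>

lemma factor_of_ruler_short:
  assumes "ruler k = u @ v @ w" "\<And>l. l \<in> set v \<Longrightarrow> l < N"
  shows "length v < 2 ^ N"
  using assms
proof (induction k arbitrary: u w)
  case 0
  show ?case
  proof (cases "v = []")
    case False
    then obtain l where "l \<in> set v" by (cases v) auto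
    then have "(2::nat) ^ 1 \<le> 2 ^ N" using 0(2)[of l] by (intro power_increasing) auto
    moreover have "length v \<le> 1" using arg_cong[OF 0(1), of length] by simp
    ultimately show ?thesis by simp
  qed simp
next
  case (Suc k)
  show ?case
  proof (cases "Suc k \<in> set v")
    case True
    have "length v \<le> length (ruler (Suc k))" unfolding Suc.prems(1) by simp
    also have "\<dots> < 2 ^ (Suc k + 1)" using length_ruler[of "Suc k"] by linarith
    also have "\<dots> \<le> 2 ^ N" using Suc.prems(2)[OF True] by (intro power_increasing) auto
    finally show ?thesis .
  next
    case False
    have "ruler k @ (Suc k # ruler k) = u @ (v @ w)" using Suc.prems(1) by simp
    then consider us where "ruler k = u @ us" "us @ (Suc k # ruler k) = v @ w"
      | us where "ruler k @ us = u" "Suc k # ruler k = us @ v @ w"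
      unfolding append_eq_append_conv2 by blast
    then show ?thesis
    proof cases
      case 1
      then consider ys where "us = v @ ys" | ys where "us @ ys = v" "Suc k # ruler k = ys @ w"
        unfolding append_eq_append_conv2 by blast
      then show ?thesis
      proof cases
        case 1
        then show ?thesis using Suc.IH[of u ys] \<open>ruler k = u @ us\<close> Suc.prems(2) by simp
      next
        case 2
        then have "ys = []" using False by (cases ys) auto
        then show ?thesis using Suc.IH[of u "[]"] \<open>ruler k = u @ us\<close> 2 Suc.prems(2) by simp
      qed
    next
      case 2
      show ?thesis
      proof (cases us)
        case Nil
        then have "v = []" using 2 False by (cases v) auto
        then show ?thesis by simp
      next
        case (Cons a zs)
        then show ?thesis using Suc.IH[of zs w] 2 Suc.prems(2) by simp
      qed
    qed
  qed
qed

text \<open>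
  The letters of a prefix have average at most one. A prefix that reaches beyond the middle letter
  consists of \<open>ruler k\<close>, the letter \<open>Suc k\<close> and a shorter prefix; the first two parts have total exactly
  \<open>length (ruler k)\<close>.
\<close>

lemma ruler_prefix_sum: "ruler k = p @ s \<Longrightarrow> sum_list p \<le> length p"
proof (induction k arbitrary: p s)
  case 0
  then show ?case by (cases p) (auto simp: Cons_eq_append_conv)
next
  case (Suc k)
  have "ruler k @ (Suc k # ruler k) = p @ s" using Suc.prems by simp
  then consider us where "ruler k = p @ us" | us where "ruler k @ us = p" "Suc k # ruler k = us @ s"
    unfolding append_eq_append_conv2 by blast
  then show ?case
  proof cases
    case 1 then show ?thesis by (rule Suc.IH)
  next
    case 2
    show ?thesis
    proof (cases us)
      case Nil
      then show ?thesis using 2 Suc.IH[of "ruler k" "[]"] by simp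
    next
      case (Cons a zs)
      then have "sum_list zs \<le> length zs" "a = Suc k" using Suc.IH[of zs s] 2 by auto
      then show ?thesis
        using 2 Cons sum_list_ruler[of k] length_ruler[of k] by (simp flip: 2(1))
    qed
  qed
qed

definition finite_alphabet :: "(nat list \<Rightarrow> complex) set" where
  "finite_alphabet = {f \<in> carrier ruler.A. \<exists>N. \<forall>w. f w \<noteq> 0 \<longrightarrow> set w \<subseteq> {..<N}}"

abbreviation ruler_alg :: "(nat list \<Rightarrow> complex) nalg" where
  "ruler_alg \<equiv> sub_nalg ruler.A finite_alphabet"

lemma ruler_alg_normed: "complex_normed_algebra ruler_alg"
proof (rule ruler.subalgebra)
  fix f g assume f: "f \<in> finite_alphabet" and g: "g \<in> finite_alphabet"
  then have c: "f \<in> carrier ruler.A" "g \<in> carrier ruler.A" by (auto simp: finite_alphabet_def)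
  obtain N1 N2 where N: "\<And>w. f w \<noteq> 0 \<Longrightarrow> set w \<subseteq> {..<N1}" "\<And>w. g w \<noteq> 0 \<Longrightarrow> set w \<subseteq> {..<N2}"
    using f g by (auto simp: finite_alphabet_def)
  have sub: "{..<N1} \<subseteq> {..<max N1 N2}" "{..<N2} \<subseteq> {..<max N1 N2}" by auto
  have "set w \<subseteq> {..<max N1 N2}" if "f w + g w \<noteq> 0" for w
    using that N[of w] sub by (cases "f w = 0") auto
  then show "f \<oplus>\<^bsub>ruler.A\<^esub> g \<in> finite_alphabet"
    using ruler.M.add.m_closed[OF c] unfolding finite_alphabet_def by auto
  have "set w \<subseteq> {..<max N1 N2}" if "word_conv ruler_words f g w \<noteq> 0" for w
  proof -
    have "(\<Sum>k\<le>length w. f (take k w) * g (drop k w)) \<noteq> 0"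
      using that by (auto simp: word_conv_def split: if_splits)
    then obtain k where "f (take k w) * g (drop k w) \<noteq> 0"
      using sum.not_neutral_contains_not_neutral by blast
    then have "set (take k w) \<union> set (drop k w) \<subseteq> {..<max N1 N2}"
      using N(1)[of "take k w"] N(2)[of "drop k w"] sub by auto
    then show ?thesis by (metis append_take_drop_id set_append)
  qed
  then show "f \<otimes>\<^bsub>ruler.A\<^esub> g \<in> finite_alphabet"
    using ruler.mult_closed[OF c] unfolding finite_alphabet_def by auto
next
  fix c f assume f: "f \<in> finite_alphabet"
  then have "f \<in> carrier ruler.A" by (auto simp: finite_alphabet_def)
  from ruler.csmult_closed[OF this, of c] f show "c \<odot>\<^bsub>ruler.A\<^esub> f \<in> finite_alphabet"
    by (auto simp: finite_alphabet_def)
qed (auto simp: finite_alphabet_def)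

text \<open>
  Over a finite alphabet there are only finitely many words, of length less than \<open>2\<^sup>N\<close>, so the weight
  \<open>t\<^bsup>length w\<^esup>\<close> is bounded below for every \<open>t\<close>.
\<close>

lemma ruler_finite_jsr:
  assumes "M \<in> M_f ruler_alg" shows "joint_spectral_radius ruler.A M = 0"
proof (rule antisym)
  have M: "M \<noteq> {}" "finite M" "M \<subseteq> finite_alphabet" using assms by (auto simp: M_f_def)
  then have "M \<in> M_f ruler.A" by (auto simp: M_f_def finite_alphabet_def)
  then have Mb: "M \<in> M_b ruler.A" using ruler.M_f_subset_M_c ruler.M_c_subset_M_b by blast
  then obtain B where Mc: "M \<subseteq> carrier ruler.A" and B: "\<And>a. a \<in> M \<Longrightarrow> alg_norm ruler.A a \<le> B"
    unfolding ruler.M_b_iff by blast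
  have "\<exists>N. \<forall>a\<in>M. \<forall>w. a w \<noteq> 0 \<longrightarrow> set w \<subseteq> {..<N}"
    using M(2,3)
  proof (induction M)
    case (insert a M)
    then obtain N where N: "\<forall>a\<in>M. \<forall>w. a w \<noteq> 0 \<longrightarrow> set w \<subseteq> {..<N}" by blast
    obtain N' where "\<forall>w. a w \<noteq> 0 \<longrightarrow> set w \<subseteq> {..<N'}" using insert.prems by (auto simp: finite_alphabet_def)
    with N show ?case by (intro exI[of _ "max N N'"]) fastforce
  qed simp
  then obtain N where N: "\<And>a w. \<lbrakk>a \<in> M; a w \<noteq> 0\<rbrakk> \<Longrightarrow> set w \<subseteq> {..<N}" by blast
  have "joint_spectral_radius ruler.A M \<le> t * B" if t: "0 < t" "t < 1" for t
  proof (rule ruler.jsr_le_weighted[OF Mb, where \<omega> = "\<lambda>w. t ^ length w" and T = "{w. set w \<subseteq> {..<N}}"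
      and C = 1 and c = "t ^ 2 ^ N"])
    show "t ^ 2 ^ N \<le> t ^ length w" if w: "w \<in> ruler_words \<inter> {w. set w \<subseteq> {..<N}}" for w
    proof (rule power_decreasing)
      obtain k u v where "ruler k = u @ w @ v" using w by (auto simp: ruler_words_def)
      then have "length w < 2 ^ N" by (rule factor_of_ruler_short) (use w in auto)
      then show "length w \<le> 2 ^ N" by simp
    qed (use t in auto)
    fix a assume a: "a \<in> M"
    have as: "(\<lambda>w. cmod (a w)) summable_on UNIV" and supp: "\<And>w. w \<notin> ruler_words \<Longrightarrow> a w = 0"
      using a Mc by auto
    have ts: "(\<lambda>w. t * cmod (a w)) summable_on UNIV" using as by (rule summable_on_cmult_right)
    have pt: "t ^ length w * cmod (a w) \<le> t * cmod (a w)" for w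
    proof (cases "a w = 0")
      case False
      then have "1 \<le> length w" using supp ruler.nonempty by (cases w) auto
      then have "t ^ length w \<le> t ^ 1" using t by (intro power_decreasing) auto
      then show ?thesis by (simp add: mult_right_mono)
    qed simp
    have "(\<Sum>\<^sub>\<infinity>w. t ^ length w * cmod (a w)) \<le> (\<Sum>\<^sub>\<infinity>w. t * cmod (a w))"
      by (rule infsum_mono[OF summable_on_comparison_test[OF ts pt] ts pt]) (use t in simp)
    also have "\<dots> = t * (\<Sum>\<^sub>\<infinity>w. cmod (a w))" by (rule infsum_cmult_right')
    also have "\<dots> \<le> t * B" using B[OF a] t by (intro mult_left_mono) auto
    finally show "(\<Sum>\<^sub>\<infinity>w. t ^ length w * cmod (a w)) \<le> t * B" .
  qed (use t N in \<open>auto simp: power_add power_le_one\<close>)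
  then show "joint_spectral_radius ruler.A M \<le> 0" by (rule nonpos_if_le_small_multiples)
  show "0 \<le> joint_spectral_radius ruler.A M" by (rule ruler.jsr_nonneg[OF Mb])
qed

text \<open>
  Let \<open>x\<^sub>i\<close> be the letter \<open>i\<close> scaled by \<open>2\<^bsup>-i\<^esup>\<close>. If all \<open>x\<^sub>i\<close> were in \<open>R_c\<close>, then removing the members
  \<open>x\<^sub>0\<close> and \<open>x\<^sub>1\<close> from the precompact set of all \<open>x\<^sub>i\<close> would not change its joint spectral radius. But
  prefixes of ruler words show that the full set has radius at least \<open>1/2\<close>, while the remaining set has
  norm \<open>1/4\<close>.
\<close>

lemma ruler_R_c_proper: "R_c ruler_alg \<noteq> carrier ruler_alg"
proof
  assume eq: "R_c ruler_alg = carrier ruler_alg"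
  interpret S: complex_normed_algebra ruler_alg by (rule ruler_alg_normed)
  define x where "x = (\<lambda>i. ruler.basis ((1 / 2) ^ i) [i])"
  have mid: "\<exists>u w. ruler i = u @ [i] @ w" for i by (cases i) auto
  have letter: "[i] \<in> ruler_words" for i using mid[of i] by (auto simp: ruler_words_def)
  have x: "x i \<in> carrier ruler_alg" for i
  proof -
    have "x i \<in> carrier ruler.A" unfolding x_def using letter by (rule ruler.basis_closed)
    moreover have "\<forall>w. x i w \<noteq> 0 \<longrightarrow> set w \<subseteq> {..<Suc i}" by (auto simp: x_def ruler.basis_def)
    ultimately show ?thesis by (auto simp: finite_alphabet_def)
  qed
  have norm_x: "alg_norm ruler_alg (x i) = (1 / 2) ^ i" for i
    by (simp add: x_def ruler.norm_basis norm_power norm_divide)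
  have Mc: "x ` {N..} \<in> M_c ruler_alg" for N
  proof (rule S.null_sequence_precompact[OF x])
    show "(\<lambda>i. alg_norm ruler_alg (x i)) \<longlonglongrightarrow> 0"
      unfolding norm_x by (rule LIMSEQ_realpow_zero) auto
  qed
  have drop: "joint_spectral_radius ruler_alg (x ` {N..}) = joint_spectral_radius ruler_alg (x ` {Suc N..})" for N
  proof -
    have "x ` {N..} = {x N} \<union> x ` {Suc N..}" using atLeast_Suc_greaterThan[of N] by (auto simp: Suc_le_eq order_le_less)
    moreover have "x N \<in> R_c ruler_alg" using eq x by simp
    ultimately show ?thesis using Mc[of "Suc N"] by (simp add: R_c_def jsr_radical_def)
  qed
  have "joint_spectral_radius ruler_alg (x ` {2..}) \<le> set_norm ruler_alg (x ` {2..})"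
    using Mc S.M_c_subset_M_b by (intro S.jsr_le_set_norm) blast
  also have "\<dots> \<le> (1 / 2) ^ 2"
  proof (rule S.set_norm_le)
    fix a assume "a \<in> x ` {2..}"
    then obtain i where "a = x i" "2 \<le> i" by auto
    then have "alg_norm ruler_alg a = (1 / 2) ^ i" using norm_x by (simp only:)
    also have "\<dots> \<le> (1 / 2) ^ 2" using \<open>2 \<le> i\<close> by (intro power_decreasing) auto
    finally show "alg_norm ruler_alg a \<le> (1 / 2) ^ 2" .
  qed simp
  finally have "joint_spectral_radius ruler_alg (x ` {2..}) \<le> 1 / 4" by (simp add: power2_eq_square)
  moreover have "joint_spectral_radius ruler_alg (x ` {0..}) = joint_spectral_radius ruler_alg (x ` {2..})"
    using drop[of 0] drop[of 1] by (simp add: numeral_2_eq_2)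
  moreover have "1 / 2 \<le> joint_spectral_radius ruler_alg (x ` {0..})"
  proof (rule S.jsr_geI)
    show b: "x ` {0..} \<in> M_b ruler_alg" using Mc S.M_c_subset_M_b by blast
    fix n :: nat assume n: "n \<ge> 1"
    \<comment> \<open>any long enough ruler word would do in place of \<open>ruler n\<close>\<close>
    define w where "w = take n (ruler n)"
    have "n < length (ruler n)" using length_ruler[of n] less_exp[of "n + 1"] by linarith
    then have len: "length w = n" by (simp add: w_def)
    have split: "ruler n = w @ drop n (ruler n)" by (simp add: w_def)
    have "w \<noteq> []" using n len by auto
    then have "w \<in> ruler_words" unfolding ruler_words_def using split by (metis (mono_tags, lifting) CollectI append_Nil)
    then have "ruler.basis (\<Prod>l\<leftarrow>w. (1 / 2) ^ l) w \<in> set_power ruler.A (x ` {0..}) (length w)"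
      by (rule ruler.basis_in_set_power) (simp add: x_def)
    moreover have "(\<Prod>l\<leftarrow>v. (1 / 2 :: complex) ^ l) = (1 / 2) ^ sum_list v" for v
      by (induction v) (simp_all add: power_add)
    ultimately have "ruler.basis ((1 / 2) ^ sum_list w) w \<in> set_power ruler_alg (x ` {0..}) n"
      by (simp add: len set_power_sub_nalg)
    then have "alg_norm ruler_alg (ruler.basis ((1 / 2) ^ sum_list w) w)
        \<le> set_norm ruler_alg (set_power ruler_alg (x ` {0..}) n)"
      by (rule S.norm_le_set_norm[OF S.set_power_bounded[OF b n]])
    then have "(1 / 2) ^ sum_list w \<le> set_norm ruler_alg (set_power ruler_alg (x ` {0..}) n)"
      by (simp add: ruler.norm_basis norm_power norm_divide)
    moreover have "(1 / 2 :: real) ^ n \<le> (1 / 2) ^ sum_list w"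
      using ruler_prefix_sum[OF split] len by (intro power_decreasing) auto
    ultimately show "(1 / 2) ^ n \<le> set_norm ruler_alg (set_power ruler_alg (x ` {0..}) n)" by linarith
  qed simp
  ultimately show False by simp
qed

section \<open>Comparison of the three radicals\<close>

lemma BA_subset_NA: "BA \<subseteq> NA"
  by (auto simp: BA_def)

text \<open>
  The function space has the cardinality of the continuum: a function is coded by the set of all
  triples of a word, a choice of real or imaginary part, and an element of the set of naturals that
  codes the corresponding real number.
\<close>

lemma function_space_embeds:
  assumes "continuum_embeds TYPE('a)"
  obtains h :: "(nat list \<Rightarrow> complex) \<Rightarrow> 'a" where "inj h"
proof -
  obtain e :: "nat set \<Rightarrow> real" where e: "bij e"
    using nat_sets_eqpoll_reals by (auto simp: eqpoll_def)
  define d where "d = inv_into UNIV e"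
  have d: "inj d" unfolding d_def using e by (metis bij_imp_bij_inv bij_is_inj)
  define G :: "(nat list \<Rightarrow> complex) \<Rightarrow> nat set" where
    "G f = {to_nat (w, b, n) | w b n. n \<in> d (if b then Re (f w) else Im (f w))}" for f
  have mem: "to_nat (w, b, n) \<in> G f \<longleftrightarrow> n \<in> d (if b then Re (f w) else Im (f w))" for f w b n
    by (auto simp: G_def)
  have "inj G"
  proof (rule injI, rule ext)
    fix f g w assume "G f = G g"
    then have "d (if b then Re (f w) else Im (f w)) = d (if b then Re (g w) else Im (g w))" for b
      using mem[of w b _ f] mem[of w b _ g] by blast
    then have "Re (f w) = Re (g w)" "Im (f w) = Im (g w)"
      using d by (metis (full_types) injD)+
    then show "f w = g w" by (rule complex_eqI)
  qed
  moreover obtain i :: "complex \<Rightarrow> 'a" where "inj i" using assms by (auto simp: continuum_embeds_def)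
  moreover have "inj (\<lambda>r. complex_of_real r)" by (rule inj_of_real)
  ultimately have "inj (i \<circ> complex_of_real \<circ> e \<circ> G)"
    using bij_is_inj[OF e] by (intro inj_compose)
  then show ?thesis by (rule that)
qed

theorem theorem4p27:
  assumes "continuum_embeds TYPE('a)"
  shows "strictly_below (NA :: 'a nalg set) R_c R_f \<and>
         strictly_below (BA :: 'a nalg set) R_b R_c \<and>
         \<not> topological_radical (R_b :: 'a nalg \<Rightarrow> 'a set)"
proof -
  obtain h :: "(nat list \<Rightarrow> complex) \<Rightarrow> 'a" where h: "inj h" using function_space_embeds[OF assms] .
  interpret r: transported ruler_alg h using ruler_alg_normed h by (simp add: transported_def transported_axioms_def)
  interpret a: transported alt.A h using alt.word_algebra h by (simp add: transported_def transported_axioms_def)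
  have "R_c r.B \<noteq> R_f r.B"
  proof -
    have "R_f ruler_alg = carrier ruler_alg"
      using complex_normed_algebra.R_f_eq_carrier[OF ruler_alg_normed] ruler_finite_jsr
      by (simp add: jsr_sub_nalg)
    then have "R_c ruler_alg \<noteq> R_f ruler_alg" using ruler_R_c_proper by simp
    then show ?thesis unfolding r.R_c_transport r.R_f_transport using h by (simp add: inj_image_eq_iff)
  qed
  then have 1: "strictly_below (NA :: 'a nalg set) R_c R_f"
    unfolding strictly_below_def using R_c_subset_R_f r.NA_transport by blast
  have x: "alt.basis 1 [0] \<in> carrier alt.A"
    by (rule alt.basis_closed) (simp add: alternating_words_def)
  have proper: "R_b alt.A \<noteq> carrier alt.A" using alternating_zero_notin_R_b x by blast
  have aB: "a.B \<in> BA" by (rule a.BA_transport[OF alt.word_alg_Banach])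
  have "R_b a.B \<noteq> R_c a.B"
  proof -
    have "R_c alt.A = carrier alt.A" using alternating_precompact_jsr by (rule alt.R_c_eq_carrier)
    then show ?thesis unfolding a.R_b_transport a.R_c_transport using h proper by (simp add: inj_image_eq_iff)
  qed
  then have 2: "strictly_below (BA :: 'a nalg set) R_b R_c"
    unfolding strictly_below_def using R_b_subset_R_c BA_subset_NA aB by blast
  have 3: "\<not> topological_radical (R_b :: 'a nalg \<Rightarrow> 'a set)"
  proof (rule not_topological_radicalI[OF aB])
    show "R_b a.B \<noteq> carrier a.B"
      unfolding a.R_b_transport a.transport_sel(1) using h proper by (simp add: inj_image_eq_iff)
    fix x y assume I: "closed_alg_ideal a.B (R_b a.B)" and xy: "x \<in> carrier a.B" "y \<in> carrier a.B"
    obtain f g where "f \<in> carrier alt.A" "g \<in> carrier alt.A" "x = h f" "y = h g"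
      using xy unfolding a.transport_sel(1) by blast
    moreover have "closed_alg_ideal alt.A (R_b alt.A)"
      using I unfolding a.R_b_transport by (rule a.closed_alg_ideal_transport)
    ultimately show "x \<otimes>\<^bsub>a.B\<^esub> y \<in> R_b a.B"
      using alternating_products unfolding a.R_b_transport by (simp only: a.transport_sel(2)) blast
  qed
  show ?thesis using 1 2 3 by blast
qed

end
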